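(* Let $d\le n$ be positive integers, let $\bm P=(\bm P_{\mathrm I},\bm P_{\mathrm{II}})\in\mathbb P^{d\times n}$ be a projection matrix with $\bm P_{\mathrm I}\in\mathbb R^{d\times d}$ invertible, and put $\bm Q=\bm P_{\mathrm I}^{-1}\bm P_{\mathrm{II}}$. Let $\alpha\ge\beta>\frac{n-d}{2}$ be real numbers with $\frac{d}{2\alpha}+\frac{n-d}{2\beta}<1$, and let $\mu\in[0,\alpha]$, $\nu\in[0,\beta]$. Then there is a constant $C>0$, independent of $u$, $K$ and $L$, such that for every quasiperiodic function $u\in\mathcal H^{\alpha,\beta}_{\mathcal Q}$ and all positive integers $K,L$, the interpolation operator $\mathcal I_{K,L}$ satisfies $$|u-\mathcal I_{K,L}u|_{\mu,\nu}\le C\,\big(K^{-\alpha}+L^{-\beta}\big)\big(K^{\mu}+L^{\nu}\big)\,|u|_{\alpha,\beta},$$ $$\|u-\mathcal I_{K,L}u\|_{\mu,\nu}\le C\,\big(K^{-\alpha}+L^{-\beta}\big)\big(K^{\mu}+L^{\nu}\big)\,\|u\|_{\alpha,\beta}.$$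
   Context: Projection matrices: $\mathbb P^{d\times n}$ is the set of $\bm P=(\bm p_1,\dots,\bm p_n)\in\mathbb R^{d\times n}$ of rank $d$ whose columns $\bm p_1,\dots,\bm p_n\in\mathbb R^d$ are linearly independent over $\mathbb Q$. Write $\bm P=(\bm P_{\mathrm I},\bm P_{\mathrm{II}})$ with $\bm P_{\mathrm I}\in\mathbb R^{d\times d}$ (assumed invertible throughout), $\bm P_{\mathrm{II}}\in\mathbb R^{d\times(n-d)}$, and $\bm Q=\bm P_{\mathrm I}^{-1}\bm P_{\mathrm{II}}$. Correspondingly write $\bm k=(\bm k_{\mathrm I}^T,\bm k_{\mathrm{II}}^T)^T\in\mathbb Z^n$ with $\bm k_{\mathrm I}\in\mathbb Z^d$, $\bm k_{\mathrm{II}}\in\mathbb Z^{n-d}$. Thus $\bm P_{\mathrm I}^{-1}\bm P\bm k=\bm k_{\mathrm I}+\bm Q\bm k_{\mathrm{II}}$. Quasiperiodic functions: with $\bm P$ fixed, a function $u:\mathbb R^d\to\mathbb C$ is quasiperiodic if $u(\bm x)=U(\bm P^T\bm x)$ for all $\bm x\in\mathbb R^d$, where $U$ (the parent function) is a continuous function on $\mathbb R^n$, $2\pi$-periodic in each variable, i.e. a continuous function on $\mathbb T^n=(\mathbb R/2\pi\mathbb Z)^n$. Its Fourier coefficients are $\hat U_{\bm k}=\frac1{(2\pi)^n}\int_{[0,2\pi]^n}U(\bm y)e^{-i\bm k\cdot\bm y}\,d\bm y$, $\bm k\in\mathbb Z^n$. Let $\varphi_{\bm k}(\bm y)=e^{i\bm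 k\cdot\bm y}$ and $\varphi_{\bm P\bm k}(\bm x)=e^{i(\bm P\bm k)\cdot\bm x}$; the function $\varphi_{\bm P\bm k}$ is quasiperiodic with parent function $\varphi_{\bm k}$. Norms: for vectors, $\|\cdot\|$ is the Euclidean norm, and $0^0=1$. For $\alpha,\beta\ge0$, $$|u|_{\alpha,\beta}=\Big(\sum_{\bm k\in\mathbb Z^n}\big(\|\bm k_{\mathrm I}+\bm Q\bm k_{\mathrm{II}}\|^{2\alpha}+\|\bm k_{\mathrm{II}}\|^{2\beta}\big)|\hat U_{\bm k}|^2\Big)^{1/2},\quad \|u\|_{\alpha,\beta}=\Big(\sum_{\bm k\in\mathbb Z^n}\big(1+\|\bm k_{\mathrm I}+\bm Q\bm k_{\mathrm{II}}\|^{2\alpha}+\|\bm k_{\mathrm{II}}\|^{2\beta}\big)|\hat U_{\bm k}|^2\Big)^{1/2},$$ and $u\in\mathcal H^{\alpha,\beta}_{\mathcal Q}$ means $\|u\|_{\alpha,\beta}<\infty$. Interpolation: for positive integers $K,L$ let $$\mathcal K_{K,L}=\{\bm k\in\mathbb Z^n:\ \bm k_{\mathrm{II}}\in[-L,L)^{n-d},\ \bm k_{\mathrm I}+\bm Q\bm k_{\mathrm{II}}\in[-K,K)^d\},$$ $$\mathcal G_{K,L}=\{(\pi\bm\ell_1^T/K,\ \pi\bm\ell_2^T/L)^T:\ \bm\ell_1\in\mathbb Z^d\cap[0,2K)^d,\ \bm\ell_2\in\mathbb Z^{n-d}\cap[0,2L)^{n-d}\}.$$ Then $$\mathcal I_{K,L}u=\sum_{\bm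 k\in\mathcal K_{K,L}}\tilde U_{\bm k}\,\varphi_{\bm P\bm k},\qquad \tilde U_{\bm k}=\frac1{2^nK^dL^{n-d}}\sum_{\bm y\in\mathcal G_{K,L}}U(\bm y)\overline{\varphi_{\bm k}(\bm y)}.$$ *)

theory Defs
  imports "HOL-Analysis.Analysis"
begin

text \<open>
  \<^bold>\<open>Block decomposition.\<close> The dimensions are \<open>d = CARD('d)\<close> and \<open>n = CARD('n)\<close>. The choice of the
  \<open>d\<close> columns that form the block \<open>I\<close> is an injection \<open>emb :: 'd \<Rightarrow> 'n\<close>; the remaining \<open>n - d\<close>
  indices \<open>- range emb\<close> form the block \<open>II\<close>. Types are nonempty, so a separate index type for
  block \<open>II\<close> would exclude \<open>n = d\<close>. Instead, \<open>\<real>\<^sup>n\<^sup>-\<^sup>d\<close> is identified with the vectors of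
  \<open>\<real>\<^sup>n\<close> that vanish on \<open>range emb\<close>, and \<open>d \<times> (n - d)\<close> matrices with the \<open>d \<times> n\<close> matrices whose
  columns in \<open>range emb\<close> vanish. Euclidean norms and matrix-vector products are unaffected.
\<close>

definition projection_matrices :: "(real^'n^'d) set" where
  "projection_matrices = {P. rank P = CARD('d) \<and>
     (\<forall>c :: 'n \<Rightarrow> rat. (\<Sum>j\<in>UNIV. of_rat (c j) *\<^sub>R column j P) = 0 \<longrightarrow> (\<forall>j. c j = 0))}"

definition block1 :: "('d \<Rightarrow> 'n) \<Rightarrow> real^'n^'d \<Rightarrow> real^'d^'d" where
  "block1 emb P = (\<chi> i j. P $ i $ emb j)"

definition block2 :: "('d \<Rightarrow> 'n) \<Rightarrow> real^'n^'d \<Rightarrow> real^'n^'d" where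
  "block2 emb P = (\<chi> i j. if j \<in> range emb then 0 else P $ i $ j)"

definition Qmat :: "('d \<Rightarrow> 'n) \<Rightarrow> real^'n^'d \<Rightarrow> real^'n^'d" where
  "Qmat emb P = matrix_inv (block1 emb P) ** block2 emb P"

definition real_vec :: "int^'n \<Rightarrow> real^'n" where
  "real_vec k = (\<chi> j. real_of_int (k $ j))"

definition part1 :: "('d \<Rightarrow> 'n) \<Rightarrow> int^'n \<Rightarrow> real^'d" where
  "part1 emb k = (\<chi> i. real_of_int (k $ emb i))"

definition part2 :: "('d \<Rightarrow> 'n) \<Rightarrow> int^'n \<Rightarrow> real^'n" where
  "part2 emb k = (\<chi> j. if j \<in> range emb then 0 else real_of_int (k $ j))"

definition freq :: "('d \<Rightarrow> 'n) \<Rightarrow> real^'n^'d \<Rightarrow> int^'n \<Rightarrow> real^'d" where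
  "freq emb P k = part1 emb k + Qmat emb P *v part2 emb k"

definition continuous_on_torus :: "(real^'n \<Rightarrow> complex) \<Rightarrow> bool" where
  "continuous_on_torus U \<longleftrightarrow>
     continuous_on UNIV U \<and> (\<forall>y j. U (y + (2 * pi) *\<^sub>R axis j 1) = U y)"

definition is_parent :: "real^'n^'d \<Rightarrow> (real^'n \<Rightarrow> complex) \<Rightarrow> (real^'d \<Rightarrow> complex) \<Rightarrow> bool" where
  "is_parent P U u \<longleftrightarrow> continuous_on_torus U \<and> (\<forall>x. u x = U (transpose P *v x))"

definition quasiperiodic :: "real^'n^'d \<Rightarrow> (real^'d \<Rightarrow> complex) \<Rightarrow> bool" where
  "quasiperiodic P u \<longleftrightarrow> (\<exists>U. is_parent P U u)"

text \<open>
  For \<open>P \<in> projection_matrices\<close> the parent function of a quasiperiodic function is unique: by the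
  rational independence of the columns, the image of \<open>x \<mapsto> P\<^sup>T x\<close> is dense in the torus.
\<close>

definition parent :: "real^'n^'d \<Rightarrow> (real^'d \<Rightarrow> complex) \<Rightarrow> real^'n \<Rightarrow> complex" where
  "parent P u = (THE U. is_parent P U u)"

definition phi :: "int^'n \<Rightarrow> real^'n \<Rightarrow> complex" where
  "phi k y = exp (\<i> * complex_of_real (real_vec k \<bullet> y))"

definition phiP :: "real^'n^'d \<Rightarrow> int^'n \<Rightarrow> real^'d \<Rightarrow> complex" where
  "phiP P k x = exp (\<i> * complex_of_real ((P *v real_vec k) \<bullet> x))"

definition fourier_coeff :: "(real^'n \<Rightarrow> complex) \<Rightarrow> int^'n \<Rightarrow> complex" where
  "fourier_coeff U k =
     complex_of_real (1 / (2 * pi) ^ CARD('n)) *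
     integral (cbox 0 (\<chi> j. 2 * pi)) (\<lambda>y. U y * exp (- \<i> * complex_of_real (real_vec k \<bullet> y)))"

text \<open>The power \<open>x\<^sup>a\<close> for \<open>x, a \<ge> 0\<close> with \<open>0\<^sup>0 = 1\<close>; note that \<open>0 powr 0 = 0\<close>.\<close>

definition rpow :: "real \<Rightarrow> real \<Rightarrow> real" where
  "rpow x a = (if a = 0 then 1 else x powr a)"

definition ennsqrt :: "ennreal \<Rightarrow> ennreal" where
  "ennsqrt x = (if x = \<infinity> then \<infinity> else ennreal (sqrt (enn2real x)))"

definition qp_seminorm ::
    "('d \<Rightarrow> 'n) \<Rightarrow> real^'n^'d \<Rightarrow> real \<Rightarrow> real \<Rightarrow> (real^'d \<Rightarrow> complex) \<Rightarrow> ennreal" where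
  "qp_seminorm emb P \<alpha> \<beta> u = ennsqrt (\<Sum>\<^sub>\<infinity>k. ennreal (
     (rpow (norm (freq emb P k)) (2 * \<alpha>) + rpow (norm (part2 emb k)) (2 * \<beta>)) *
     (cmod (fourier_coeff (parent P u) k))\<^sup>2))"

definition qp_norm ::
    "('d \<Rightarrow> 'n) \<Rightarrow> real^'n^'d \<Rightarrow> real \<Rightarrow> real \<Rightarrow> (real^'d \<Rightarrow> complex) \<Rightarrow> ennreal" where
  "qp_norm emb P \<alpha> \<beta> u = ennsqrt (\<Sum>\<^sub>\<infinity>k. ennreal (
     (1 + rpow (norm (freq emb P k)) (2 * \<alpha>) + rpow (norm (part2 emb k)) (2 * \<beta>)) *
     (cmod (fourier_coeff (parent P u) k))\<^sup>2))"

definition HQ ::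
    "('d \<Rightarrow> 'n) \<Rightarrow> real^'n^'d \<Rightarrow> real \<Rightarrow> real \<Rightarrow> (real^'d \<Rightarrow> complex) set" where
  "HQ emb P \<alpha> \<beta> = {u. quasiperiodic P u \<and> qp_norm emb P \<alpha> \<beta> u < \<infinity>}"

definition index_set :: "('d \<Rightarrow> 'n) \<Rightarrow> real^'n^'d \<Rightarrow> nat \<Rightarrow> nat \<Rightarrow> (int^'n) set" where
  "index_set emb P K L = {k.
     (\<forall>j. j \<notin> range emb \<longrightarrow> k $ j \<in> {- int L..<int L}) \<and>
     (\<forall>i. freq emb P k $ i \<in> {- real K..<real K})}"

definition grid :: "('d \<Rightarrow> 'n) \<Rightarrow> nat \<Rightarrow> nat \<Rightarrow> (real^'n) set" where
  "grid emb K L =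
     {\<chi> j. pi * real_of_int (l $ j) / (if j \<in> range emb then real K else real L) | l :: int^'n.
        \<forall>j. l $ j \<in> {0..<2 * (if j \<in> range emb then int K else int L)}}"

definition discrete_coeff ::
    "('d::finite \<Rightarrow> 'n) \<Rightarrow> nat \<Rightarrow> nat \<Rightarrow> (real^'n \<Rightarrow> complex) \<Rightarrow> int^'n \<Rightarrow> complex" where
  "discrete_coeff emb K L U k =
     complex_of_real (1 / (2 ^ CARD('n) * real K ^ CARD('d) * real L ^ (CARD('n) - CARD('d)))) *
     (\<Sum>y\<in>grid emb K L. U y * cnj (phi k y))"

definition interpolation ::
    "('d \<Rightarrow> 'n) \<Rightarrow> real^'n^'d \<Rightarrow> nat \<Rightarrow> nat \<Rightarrow> (real^'d \<Rightarrow> complex) \<Rightarrow> real^'d \<Rightarrow> complex" where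
  "interpolation emb P K L u x =
     (\<Sum>k\<in>index_set emb P K L. discrete_coeff emb K L (parent P u) k * phiP P k x)"

end

theory Submission
  imports Defs
begin

text \<open>
  The sampling grid cannot distinguish frequencies that are congruent modulo
  \<open>2K \<int>\<^sup>d \<times> 2L \<int>\<^sup>n\<^sup>-\<^sup>d\<close>, so the discrete coefficient of \<open>k\<close> is the sum of the Fourier coefficients over
  the congruence class of \<open>k\<close>, and the index set meets each class at most once. The error
  therefore consists of the coefficients outside the index set, where the weight of \<open>|\<cdot>|\<^sub>\<alpha>\<^sub>,\<^sub>\<beta>\<close> is large, and
  of the aliased tails inside it. By Cauchy--Schwarz the latter reduce to bounding the sum of
  the inverse weights over a punctured class. Recording in which translate of the fundamental box
  a member of the class lies maps the class injectively into \<open>\<int>\<^sup>n\<close> and turns this sum into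
  \<open>K\<^sup>-\<^sup>2\<^sup>\<alpha> + L\<^sup>-\<^sup>2\<^sup>\<beta>\<close> times a lattice sum which converges exactly because \<open>d/(2\<alpha>) + (n-d)/(2\<beta>) < 1\<close>.
\<close>

text \<open>The box behind the index set is straight in the coordinates
  \<open>(k_I + Q k_II, k_II)\<close>, while aliasing acts on \<open>k\<close> itself: a shift by
  \<open>2 L z\<close> in block II moves the frequency by \<open>2 L Q z\<close>, which need not be
  a multiple of the period \<open>2 K\<close>. The translation vector of an alias therefore does not
  tell in which box it lies. What survives is a triangular structure: members of a class in the same
  box have equal block II parts, whereupon the \<open>Q\<close> terms cancel. So each box holds at
  most one member, which is all that the lattice sum requires.

  The weight vanishes at \<open>k = 0\<close> when the exponents are positive, so inverse weights
  are summed over nonzero boxes only. Neither a coefficient outside the index set nor a proper alias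
  of an index lies in box zero, and this is why the seminorm alone can stand on the right. The 1 of
  the full norm is carried along on the left, so that one estimate yields both inequalities.

  Sampling uses point values, hence absolutely convergent Fourier series; the same lattice sum
  supplies the convergence. The coefficients of the error are accessible only once its parent
  function is known to be unique.\<close>

lemma sum_vec_prod:
  fixes f :: "'n::finite \<Rightarrow> 'a \<Rightarrow> 'b::comm_semiring_1"
  assumes "\<And>j. finite (B j)"
  shows "(\<Sum>v\<in>{v. \<forall>j. v $ j \<in> B j}. \<Prod>j\<in>UNIV. f j (v $ j)) = (\<Prod>j\<in>UNIV. \<Sum>x\<in>B j. f j x)"
  unfolding prod_sum_PiE[OF finite assms]
  by (rule sum.reindex_bij_witness[where i = vec_lambda and j = vec_nth]) auto

lemma finite_vec_box:
  fixes B :: "'n::finite \<Rightarrow> 'a set"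
  assumes "\<And>j. finite (B j)"
  shows "finite {v. \<forall>j. v $ j \<in> B j}"
proof -
  have "finite (PiE UNIV B)"
    using assms by (intro finite_PiE) auto
  moreover have "{v. \<forall>j. v $ j \<in> B j} = vec_lambda ` PiE UNIV B"
    by (force simp: PiE_def image_iff intro: exI[where x = "vec_nth _"])
  ultimately show ?thesis
    by simp
qed

section \<open>Characters of the torus\<close>

lemma real_vec_nth [simp]: "real_vec k $ j = real_of_int (k $ j)"
  by (simp add: real_vec_def)

lemma real_vec_add: "real_vec (k + l) = real_vec k + real_vec l"
  by (simp add: vec_eq_iff)

lemma phi_mult: "phi k y * phi l y = phi (k + l) y"
  by (simp add: phi_def real_vec_add inner_add_left distrib_left exp_add)

lemma phi_0 [simp]: "phi 0 y = 1"
  by (simp add: phi_def inner_vec_def)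

lemma cnj_phi: "cnj (phi k y) = phi (- k) y"
  by (simp add: phi_def exp_cnj inner_vec_def sum_negf)

lemma norm_phi [simp]: "norm (phi k y) = 1"
  by (simp add: phi_def)

lemma exp_uminus_phi: "exp (- \<i> * complex_of_real (real_vec k \<bullet> y)) = phi (- k) y"
  by (simp add: phi_def inner_vec_def sum_negf)

lemma continuous_on_phi [continuous_intros]: "continuous_on S (phi k)"
  unfolding phi_def by (intro continuous_intros)

lemma phi_prod: "phi k y = (\<Prod>j\<in>UNIV. exp (\<i> * complex_of_real (real_of_int (k $ j) * y $ j)))"
  by (simp add: phi_def inner_vec_def sum_distrib_left exp_sum)

lemma exp_int_2pi: "exp (\<i> * complex_of_real (real_of_int m * (2 * pi))) = 1"
  using exp_integer_2pi[of "of_int m"] by (simp add: mult_ac)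

lemma phi_periodic: "phi k (y + (2 * pi) *\<^sub>R axis j 1) = phi k y"
  by (simp add: phi_def inner_add_right inner_axis distrib_left exp_add)
     (use exp_int_2pi[of "k $ j"] in \<open>simp add: mult_ac\<close>)

section \<open>Orthogonality of the characters\<close>

text \<open>Lebesgue measure on a Euclidean space is the image of a finite product of
  one-dimensional Lebesgue measures (\<open>lborel_eq\<close>), so Fubini for finite products
  applies.\<close>

lemma integral_lborel_prod:
  fixes f :: "'a::euclidean_space \<Rightarrow> real \<Rightarrow> complex"
  assumes f: "\<And>b. b \<in> Basis \<Longrightarrow> integrable lborel (f b)"
  shows "(LINT x|lborel. (\<Prod>b\<in>Basis. f b (x \<bullet> b))) = (\<Prod>b\<in>Basis. integral\<^sup>L lborel (f b))"
proof -
  interpret product_sigma_finite "\<lambda>b::'a. lborel :: real measure"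
    by standard
  have [measurable]: "f b \<in> borel_measurable borel" if "b \<in> Basis" for b
    using f[OF that] by auto
  have "(LINT x|lborel. (\<Prod>b\<in>Basis. f b (x \<bullet> b))) =
      (LINT g|(\<Pi>\<^sub>M b\<in>(Basis::'a set). lborel).
        (\<Prod>b\<in>Basis. f b ((\<Sum>b\<in>Basis. g b *\<^sub>R b) \<bullet> b)))"
    by (subst lborel_eq, subst integral_distr) auto
  also have "\<dots> = (LINT g|(\<Pi>\<^sub>M b\<in>(Basis::'a set). lborel). (\<Prod>b\<in>Basis. f b (g b)))"
    by (intro Bochner_Integration.integral_cong prod.cong refl) simp
  also have "\<dots> = (\<Prod>b\<in>Basis. integral\<^sup>L lborel (f b))"
    by (rule product_integral_prod) (use f in auto)
  finally show ?thesis .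
qed

lemma integral_exp_period:
  "integral {0..2 * pi} (\<lambda>x. exp (\<i> * complex_of_real (real_of_int m * x))) =
    (if m = 0 then complex_of_real (2 * pi) else 0)"
proof (cases "m = 0")
  case False
  have "((\<lambda>x. exp (\<i> * complex_of_real (real_of_int m * x))) has_integral
      (exp (\<i> * complex_of_real (real_of_int m * (2 * pi))) / (\<i> * of_int m) -
       exp (\<i> * complex_of_real (real_of_int m * 0)) / (\<i> * of_int m))) {0..2 * pi}"
    by (rule fundamental_theorem_of_calculus)
       (auto intro!: derivative_eq_intros has_vector_derivative_real_field simp: False mult_ac)
  then show ?thesis
    using False exp_int_2pi[of m] by (simp add: integral_unique)
qed (simp add: scaleR_conv_of_real)

abbreviation torus_box :: "(real^'n) set" where
  "torus_box \<equiv> cbox 0 (\<chi> j. 2 * pi)"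

lemma integral_phi:
  fixes m :: "int^'n"
  shows "integral torus_box (phi m) = (if m = 0 then complex_of_real ((2 * pi) ^ CARD('n)) else 0)"
proof -
  \<comment> \<open>The indicator of the box is distributed over the one-dimensional factors, so
    that the integral over the box becomes an integral of a product over the whole space.\<close>
  define g :: "real^'n \<Rightarrow> real \<Rightarrow> complex" where
    "g b x = indicator {0..2 * pi} x *\<^sub>R exp (\<i> * complex_of_real ((real_vec m \<bullet> b) * x))" for b x
  have int: "integrable lborel (g b)" for b
    unfolding g_def by (rule borel_integrable_compact) (auto intro!: continuous_intros)
  have prod: "indicator torus_box y *\<^sub>R phi m y = (\<Prod>b\<in>Basis. g b (y \<bullet> b))" for y :: "real^'n"
  proof -
    have "indicator torus_box y = (\<Prod>b\<in>Basis. indicator {0..2 * pi} (y \<bullet> b) :: real)"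
    proof -
      have "y \<in> torus_box \<longleftrightarrow> (\<forall>b\<in>Basis. y \<bullet> b \<in> {0..2 * pi})"
        by (auto simp: mem_box Basis_vec_def inner_axis)
      then show ?thesis
        by (cases "y \<in> torus_box") (auto simp: indicator_def)
    qed
    moreover have "phi m y = (\<Prod>b\<in>Basis. exp (\<i> * complex_of_real ((real_vec m \<bullet> b) * (y \<bullet> b))))"
      unfolding phi_def
      by (subst euclidean_inner) (simp add: sum_distrib_left exp_sum)
    ultimately show ?thesis
      by (simp add: g_def scaleR_conv_of_real prod.distrib)
  qed
  have "set_integrable lborel torus_box (phi m)"
    unfolding set_integrable_def
    by (rule borel_integrable_compact) (auto intro!: continuous_intros)
  then have "integral torus_box (phi m) = (LINT y|lborel. indicator torus_box y *\<^sub>R phi m y)"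
    by (simp add: set_borel_integral_eq_integral(2)[symmetric] set_lebesgue_integral_def)
  also have "\<dots> = (\<Prod>b\<in>Basis. integral\<^sup>L lborel (g b))"
    unfolding prod by (rule integral_lborel_prod) (rule int)
  also have "\<dots> = (\<Prod>b\<in>(\<lambda>j. axis j 1) ` UNIV. integral\<^sup>L lborel (g b))"
    by (rule prod.cong) (auto simp: Basis_vec_def)
  also have "\<dots> = (\<Prod>j\<in>UNIV. integral\<^sup>L lborel (g (axis j 1)))"
    by (subst prod.reindex) (auto simp: inj_on_def axis_eq_axis)
  also have "\<dots> = (\<Prod>j\<in>UNIV. if m $ j = 0 then complex_of_real (2 * pi) else 0)"
  proof (rule prod.cong)
    fix j
    have "integral\<^sup>L lborel (g (axis j 1)) =
        (LINT x:{0..2 * pi}|lborel. exp (\<i> * complex_of_real (real_of_int (m $ j) * x)))"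
      by (simp add: g_def[abs_def] set_lebesgue_integral_def inner_axis)
    also have "\<dots> = integral {0..2 * pi} (\<lambda>x. exp (\<i> * complex_of_real (real_of_int (m $ j) * x)))"
      by (rule set_borel_integral_eq_integral)
         (use int[of "axis j 1"] in \<open>simp add: g_def[abs_def] set_integrable_def inner_axis\<close>)
    finally show "integral\<^sup>L lborel (g (axis j 1)) =
        (if m $ j = 0 then complex_of_real (2 * pi) else 0)"
      by (simp only: integral_exp_period)
  qed simp
  also have "\<dots> = (if m = 0 then complex_of_real ((2 * pi) ^ CARD('n)) else 0)"
    by (auto simp: vec_eq_iff)
  finally show ?thesis .
qed

lemma fourier_coeff_alt:
  "fourier_coeff U k =
    complex_of_real (1 / (2 * pi) ^ CARD('n)) * integral torus_box (\<lambda>y. U y * phi (- k) y)"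
  for k :: "int^'n"
  unfolding fourier_coeff_def exp_uminus_phi ..

lemma fourier_coeff_phi: "fourier_coeff (phi l) k = (if k = l then 1 else 0)"
  by (simp add: fourier_coeff_alt phi_mult integral_phi)

lemma integrable_on_torus_box:
  fixes g :: "real^'n \<Rightarrow> complex"
  assumes "continuous_on UNIV g"
  shows "g integrable_on torus_box"
  by (meson assms continuous_on_subset integrable_continuous subset_UNIV)

lemma fourier_coeff_diff:
  assumes "continuous_on UNIV U" "continuous_on UNIV V"
  shows "fourier_coeff (\<lambda>y. U y - V y) k = fourier_coeff U k - fourier_coeff V k"
  unfolding fourier_coeff_alt left_diff_distrib
  by (subst integral_diff)
     (auto intro!: integrable_on_torus_box continuous_intros assms simp: right_diff_distrib)

lemma fourier_coeff_sum:
  assumes "finite S" "\<And>i. i \<in> S \<Longrightarrow> continuous_on UNIV (U i)"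
  shows "fourier_coeff (\<lambda>y. \<Sum>i\<in>S. c i * U i y) k = (\<Sum>i\<in>S. c i * fourier_coeff (U i) k)"
proof -
  have "integral torus_box (\<lambda>y. (\<Sum>i\<in>S. c i * U i y) * phi (- k) y) =
      integral torus_box (\<lambda>y. \<Sum>i\<in>S. c i * (U i y * phi (- k) y))"
    by (simp add: sum_distrib_right mult.assoc)
  also have "\<dots> = (\<Sum>i\<in>S. integral torus_box (\<lambda>y. c i * (U i y * phi (- k) y)))"
    by (rule integral_sum) (auto intro!: assms integrable_on_torus_box continuous_intros)
  also have "\<dots> = (\<Sum>i\<in>S. c i * integral torus_box (\<lambda>y. U i y * phi (- k) y))"
    by simp
  finally show ?thesis
    by (simp add: fourier_coeff_alt sum_distrib_left mult_ac)
qed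

lemma fourier_coeff_trig_sum:
  assumes "finite S"
  shows "fourier_coeff (\<lambda>y. \<Sum>l\<in>S. c l * phi l y) k = (if k \<in> S then c k else 0)"
  using assms
  by (subst fourier_coeff_sum)
     (auto intro!: continuous_intros simp: fourier_coeff_phi if_distrib sum.delta' cong: if_cong)

section \<open>Uniqueness and inversion of Fourier series\<close>

text \<open>Given inductively rather than as explicit finite sums: closure under products and
  orthogonality then follow by induction, without bookkeeping of index sets.\<close>

inductive trig_poly :: "(real^'n \<Rightarrow> complex) \<Rightarrow> bool" where
  monomial: "trig_poly (\<lambda>y. c * phi k y)"
| add: "trig_poly f \<Longrightarrow> trig_poly g \<Longrightarrow> trig_poly (\<lambda>y. f y + g y)"

lemma trig_poly_const: "trig_poly (\<lambda>y. c)"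
  using trig_poly.monomial[of c 0] by simp

lemma trig_poly_mult:
  assumes "trig_poly f" "trig_poly g"
  shows "trig_poly (\<lambda>y. f y * g y)"
  using assms(1)
proof induction
  case (monomial c k)
  show ?case
    using assms(2)
  proof induction
    case (monomial d l)
    have "(\<lambda>y. c * phi k y * (d * phi l y)) = (\<lambda>y. (c * d) * phi (k + l) y)"
      by (simp add: phi_mult[symmetric] mult_ac)
    then show ?case
      by (simp only: trig_poly.monomial)
  next
    case (add f g)
    then show ?case
      by (simp add: distrib_left trig_poly.add)
  qed
next
  case (add f g)
  then show ?case
    by (simp add: distrib_right trig_poly.add)
qed

lemma trig_poly_sum:
  assumes "\<And>i. i \<in> S \<Longrightarrow> trig_poly (f i)"
  shows "trig_poly (\<lambda>y. \<Sum>i\<in>S. f i y)"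
  using assms
  by (induction S rule: infinite_finite_induct) (auto intro: trig_poly_const trig_poly.add)

lemma continuous_on_trig_poly:
  assumes "trig_poly f"
  shows "continuous_on S f"
  using assms by induction (auto intro!: continuous_intros)

definition torus_embed :: "real^'n \<Rightarrow> complex^'n" where
  "torus_embed y = (\<chi> j. cis (y $ j))"

lemma continuous_on_torus_embed: "continuous_on S torus_embed"
  unfolding torus_embed_def by (intro continuous_intros)

lemma phi_axis: "phi (axis j m) y = cis (real_of_int m * y $ j)"
proof -
  have "real_vec (axis j m) = axis j (real_of_int m)"
    by (simp add: vec_eq_iff axis_def)
  then show ?thesis
    by (simp add: phi_def inner_axis' cis_conv_exp)
qed

lemma trig_poly_torus_embed_inner:
  fixes b :: "complex^'n"
  assumes "b \<in> Basis"
  shows "trig_poly (\<lambda>y. complex_of_real (torus_embed y \<bullet> b))"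
proof -
  obtain j c where b: "b = axis j c" and c: "c = 1 \<or> c = \<i>"
    using assms by (auto simp: Basis_vec_def Basis_complex_def)
  have 1: "complex_of_real (cos (y $ j)) = (1 / 2) * phi (axis j 1) y + (1 / 2) * phi (axis j (- 1)) y"
    for y :: "real^'n"
    by (simp add: phi_axis complex_eq_iff)
  have 2: "complex_of_real (sin (y $ j)) = (- \<i> / 2) * phi (axis j 1) y + (\<i> / 2) * phi (axis j (- 1)) y"
    for y :: "real^'n"
    by (simp add: phi_axis complex_eq_iff)
  show ?thesis
    using c
  proof
    assume "c = 1"
    then have "(\<lambda>y. complex_of_real (torus_embed y \<bullet> b)) = (\<lambda>y. complex_of_real (cos (y $ j)))"
      by (simp add: b inner_axis torus_embed_def inner_complex_def)
    then show ?thesis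
      unfolding 1 by (simp only: trig_poly.intros)
  next
    assume "c = \<i>"
    then have "(\<lambda>y. complex_of_real (torus_embed y \<bullet> b)) = (\<lambda>y. complex_of_real (sin (y $ j)))"
      by (simp add: b inner_axis torus_embed_def inner_complex_def)
    then show ?thesis
      unfolding 2 by (simp only: trig_poly.intros)
  qed
qed

text \<open>A linear functional is a combination of the real coordinates of points on circles, that
  is, of cosines and sines; the other ways to build a polynomial are closure properties of
  \<open>trig_poly\<close>.\<close>

lemma trig_poly_polynomial:
  fixes p :: "complex^'n \<Rightarrow> real"
  assumes "real_polynomial_function p"
  shows "trig_poly (\<lambda>y. complex_of_real (p (torus_embed y)))"
  using assms
proof induction
  case (linear p)
  have *: "p z = (\<Sum>b\<in>Basis. p b * (z \<bullet> b))" for z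
  proof -
    have "p z = p (\<Sum>b\<in>Basis. (z \<bullet> b) *\<^sub>R b)"
      by (simp add: euclidean_representation)
    also have "\<dots> = (\<Sum>b\<in>Basis. p b * (z \<bullet> b))"
      using bounded_linear.linear[OF linear]
      by (simp add: linear_sum linear_cmul mult.commute)
    finally show ?thesis .
  qed
  have "(\<lambda>y. complex_of_real (p (torus_embed y))) =
      (\<lambda>y. \<Sum>b\<in>Basis. complex_of_real (p b) * complex_of_real (torus_embed y \<bullet> b))"
    by (rule ext, subst *) simp
  then show ?case
    by (simp only:)
       (intro trig_poly_sum trig_poly_mult trig_poly_const trig_poly_torus_embed_inner)
next
  case (const c)
  show ?case by (rule trig_poly_const)
next
  case (add f g)
  then show ?case by (simp add: trig_poly.add)
next
  case (mult f g)
  then show ?case by (simp add: trig_poly_mult)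
qed

section \<open>Periodicity and representatives modulo the lattice of periods\<close>

lemma torus_periodic_axis:
  assumes "continuous_on_torus U"
  shows "U (y + (2 * pi * real_of_int z) *\<^sub>R axis j 1) = U y"
proof -
  have step: "U (y + (2 * pi) *\<^sub>R axis j 1) = U y" for y
    using assms by (simp add: continuous_on_torus_def)
  show ?thesis
  proof (induction z rule: int_induct[where k = 0])
    case (step1 i)
    have "y + (2 * pi * real_of_int (i + 1)) *\<^sub>R axis j 1 =
        (y + (2 * pi * real_of_int i) *\<^sub>R axis j 1) + (2 * pi) *\<^sub>R axis j 1"
      by (simp add: algebra_simps)
    then show ?case
      using step step1 by metis
  next
    case (step2 i)
    have "y + (2 * pi * real_of_int i) *\<^sub>R axis j 1 =
        (y + (2 * pi * real_of_int (i - 1)) *\<^sub>R axis j 1) + (2 * pi) *\<^sub>R axis j 1"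
      by (simp add: algebra_simps)
    then show ?case
      using step step2 by metis
  qed simp
qed

lemma torus_periodic:
  fixes U :: "real^'n \<Rightarrow> complex"
  assumes "continuous_on_torus U"
  shows "U (y + (2 * pi) *\<^sub>R real_vec z) = U y"
proof -
  have *: "U (y + (\<Sum>j\<in>S. (2 * pi * real_of_int (z $ j)) *\<^sub>R axis j 1)) = U y" if "finite S" for S
    using that
  proof induction
    case (insert j S)
    have "U (y + (\<Sum>j\<in>insert j S. (2 * pi * real_of_int (z $ j)) *\<^sub>R axis j 1)) =
       U ((y + (\<Sum>j\<in>S. (2 * pi * real_of_int (z $ j)) *\<^sub>R axis j 1)) +
        (2 * pi * real_of_int (z $ j)) *\<^sub>R axis j 1)"
      using insert by (simp add: add_ac)
    then show ?case
      using insert torus_periodic_axis[OF assms] by metis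
  qed simp
  have "(\<Sum>j\<in>UNIV. (2 * pi * real_of_int (z $ j)) *\<^sub>R axis j 1) = (2 * pi) *\<^sub>R real_vec z"
    by (simp add: vec_eq_iff axis_def if_distrib cong: if_cong)
  with *[of UNIV] show ?thesis
    by simp
qed

lemma torus_embed_eq_imp:
  assumes "continuous_on_torus U" "torus_embed x = torus_embed y"
  shows "U x = U y"
proof -
  have "\<exists>z. x $ j = y $ j + 2 * pi * real_of_int z" for j
  proof -
    have "cis (x $ j) = cis (y $ j)"
      using assms(2) by (metis (no_types) torus_embed_def vec_lambda_beta)
    then have "sin (x $ j) = sin (y $ j) \<and> cos (x $ j) = cos (y $ j)"
      by (simp add: complex_eq_iff)
    then show ?thesis
      by (simp add: sin_cos_eq_iff)
  qed
  then obtain z where z: "\<And>j. x $ j = y $ j + 2 * pi * real_of_int (z j)"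
    by metis
  have "x = y + (2 * pi) *\<^sub>R real_vec (\<chi> j. z j)"
    by (simp add: vec_eq_iff z)
  then show ?thesis
    using torus_periodic[OF assms(1)] by simp
qed

lemma torus_representative:
  fixes U :: "real^'n \<Rightarrow> complex"
  assumes "continuous_on_torus U"
  obtains y where "y \<in> torus_box" "U y = U x"
proof
  define z :: "int^'n" where "z = (\<chi> j. - \<lfloor>x $ j / (2 * pi)\<rfloor>)"
  let ?y = "x + (2 * pi) *\<^sub>R real_vec z"
  show "U ?y = U x"
    by (rule torus_periodic[OF assms])
  have "0 \<le> ?y $ j \<and> ?y $ j \<le> 2 * pi" for j
  proof -
    have "?y $ j = 2 * pi * frac (x $ j / (2 * pi))"
      by (simp add: z_def frac_def field_simps)
    then show ?thesis
      using frac_ge_0[of "x $ j / (2 * pi)"] frac_lt_1[of "x $ j / (2 * pi)"]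
      by (auto intro!: mult_nonneg_nonneg simp: mult_le_cancel_left1)
  qed
  then show "?y \<in> torus_box"
    by (auto simp: mem_box_cart)
qed

text \<open>The torus is realised as a compact subset of \<open>\<complex>\<^sup>n\<close>, on which polynomials are dense by
  Stone--Weierstrass and pull back to trigonometric polynomials.\<close>

lemma trig_poly_dense:
  fixes U :: "real^'n \<Rightarrow> complex"
  assumes U: "continuous_on_torus U" and "e > 0"
  obtains T where "trig_poly T" "\<And>y. y \<in> torus_box \<Longrightarrow> norm (U y - T y) < e"
proof -
  let ?f = "torus_embed :: real^'n \<Rightarrow> complex^'n"
  define S where "S = ?f ` torus_box"
  \<comment> \<open>The function \<open>U\<close> pushed forward to the image of the torus. The
    choice of preimage is immaterial because \<open>U\<close> is constant on the fibres of
    \<open>torus_embed\<close>.\<close>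
  define G where "G z = U (SOME y. y \<in> torus_box \<and> ?f y = z)" for z
  have G: "G (?f y) = U y" if "y \<in> torus_box" for y
  proof -
    have "\<exists>y'. y' \<in> torus_box \<and> ?f y' = ?f y"
      using that by blast
    then have "?f (SOME y'. y' \<in> torus_box \<and> ?f y' = ?f y) = ?f y"
      by (rule someI2_ex) simp
    then show ?thesis
      unfolding G_def by (rule torus_embed_eq_imp[OF U])
  qed
  have "compact S"
    unfolding S_def by (intro compact_continuous_image continuous_on_torus_embed compact_cbox)
  have contU: "continuous_on torus_box U"
    using U by (meson continuous_on_torus_def continuous_on_subset subset_UNIV)
  \<comment> \<open>Continuity descends from \<open>U\<close>: a continuous map from the compact box
    onto its Hausdorff image is a quotient map, so openness may be tested on preimages in the
    box.\<close>
  have "continuous_on S G"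
    unfolding continuous_on_open
  proof (intro allI impI)
    fix t assume t: "openin (top_of_set (G ` S)) t"
    have "openin (top_of_set S) (S \<inter> G -` t) \<longleftrightarrow>
        openin (top_of_set torus_box) (torus_box \<inter> ?f -` (S \<inter> G -` t))"
      by (rule Abstract_Topology_2.continuous_imp_quotient_map[symmetric])
         (auto simp: S_def continuous_on_torus_embed)
    also have "torus_box \<inter> ?f -` (S \<inter> G -` t) = torus_box \<inter> U -` t"
    proof -
      have "(?f y \<in> S \<and> G (?f y) \<in> t) = (U y \<in> t)" if "y \<in> torus_box" for y
        using G[OF that] that by (simp add: S_def)
      then show ?thesis
        by blast
    qed
    also have "openin (top_of_set torus_box) \<dots>"
    proof -
      have "G ` S = U ` torus_box"
        unfolding S_def image_image by (rule image_cong) (simp_all add: G)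
      then show ?thesis
        using contU t by (simp add: continuous_on_open)
    qed
    finally show "openin (top_of_set S) (S \<inter> G -` t)" .
  qed
  from Stone_Weierstrass_polynomial_function[OF \<open>compact S\<close> this \<open>e > 0\<close>]
  obtain g where g: "polynomial_function g" "\<forall>z\<in>S. norm (G z - g z) < e"
    by auto
  have re: "real_polynomial_function (\<lambda>z. Re (g z))" and im: "real_polynomial_function (\<lambda>z. Im (g z))"
    using g(1) bounded_linear_Re bounded_linear_Im by (auto simp: polynomial_function_def o_def)
  have "trig_poly (\<lambda>y. complex_of_real (Re (g (?f y))) + \<i> * complex_of_real (Im (g (?f y))))"
    by (rule trig_poly.add[OF trig_poly_polynomial[OF re]
          trig_poly_mult[OF trig_poly_const trig_poly_polynomial[OF im]]])
  then have "trig_poly (\<lambda>y. g (?f y))"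
    by (simp only: complex_eq[symmetric])
  moreover have "norm (U y - g (?f y)) < e" if "y \<in> torus_box" for y
    using g(2)[rule_format, of "?f y"] G[OF that] that by (simp add: S_def)
  ultimately show ?thesis
    using that by blast
qed

text \<open>Vanishing coefficients make \<open>W\<close> orthogonal to all trigonometric
  polynomials. Approximating the conjugate of \<open>W\<close> uniformly by these shows that the
  integral of the squared modulus is 0, and continuity does the rest.\<close>

lemma fourier_unique_zero:
  fixes W :: "real^'n \<Rightarrow> complex"
  assumes W: "continuous_on_torus W" and coeff: "\<And>k. fourier_coeff W k = 0"
  shows "W y = 0"
proof -
  have contW: "continuous_on S W" for S
    using W by (meson continuous_on_torus_def continuous_on_subset subset_UNIV)
  have orth_phi: "integral torus_box (\<lambda>y. W y * phi k y) = 0" for k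
    using coeff[of "- k"] by (simp add: fourier_coeff_alt)
  have orth: "integral torus_box (\<lambda>y. W y * T y) = 0" if "trig_poly T" for T
    using that
  proof induction
    case (monomial c k)
    have "(\<lambda>y. W y * (c * phi k y)) = (\<lambda>y. c * (W y * phi k y))"
      by (simp add: mult_ac)
    then show ?case
      by (simp add: orth_phi)
  next
    case (add f g)
    moreover have "(\<lambda>y. W y * h y) integrable_on torus_box" if "trig_poly h" for h
      by (intro integrable_on_torus_box continuous_on_mult contW continuous_on_trig_poly[OF that])
    ultimately show ?case
      by (simp add: distrib_left integral_add)
  qed
  have W': "continuous_on_torus (\<lambda>y. cnj (W y))"
    using W by (auto simp: continuous_on_torus_def intro!: continuous_intros)
  define N where "N = integral torus_box (\<lambda>y. cmod (W y))"
  have int: "(\<lambda>y. cmod (W y)) integrable_on torus_box"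
    by (intro integrable_continuous continuous_intros contW)
  have N0: "N \<ge> 0"
    unfolding N_def by (intro integral_nonneg int) auto
  have small: "cmod (integral torus_box (\<lambda>y. W y * cnj (W y))) \<le> e * N" if e: "e > 0" for e
  proof -
    obtain T where T: "trig_poly T" "\<And>y. y \<in> torus_box \<Longrightarrow> norm (cnj (W y) - T y) < e"
      using trig_poly_dense[OF W' e] by blast
    have "integral torus_box (\<lambda>y. W y * cnj (W y)) =
        integral torus_box (\<lambda>y. W y * (cnj (W y) - T y)) + integral torus_box (\<lambda>y. W y * T y)"
    proof (subst integral_add[symmetric])
      show "(\<lambda>y. W y * (cnj (W y) - T y)) integrable_on torus_box" "(\<lambda>y. W y * T y) integrable_on torus_box"
        by (intro integrable_on_torus_box continuous_intros contW continuous_on_trig_poly[OF T(1)])+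
    qed (simp add: right_diff_distrib)
    also have "\<dots> = integral torus_box (\<lambda>y. W y * (cnj (W y) - T y))"
      by (simp add: orth[OF T(1)])
    also have "cmod \<dots> \<le> integral torus_box (\<lambda>y. e * cmod (W y))"
    proof (rule integral_norm_bound_integral)
      show "(\<lambda>y. W y * (cnj (W y) - T y)) integrable_on torus_box"
        by (intro integrable_on_torus_box continuous_intros contW continuous_on_trig_poly[OF T(1)])
      show "(\<lambda>y. e * cmod (W y)) integrable_on torus_box"
        by (intro integrable_continuous continuous_intros contW)
      fix y :: "real^'n" assume "y \<in> torus_box"
      from T(2)[OF this] show "norm (W y * (cnj (W y) - T y)) \<le> e * cmod (W y)"
        by (simp add: norm_mult mult.commute[of e] mult_left_mono)
    qed
    finally show ?thesis
      by (simp add: N_def)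
  qed
  have "cmod (integral torus_box (\<lambda>y. W y * cnj (W y))) \<le> 0"
  proof (rule field_le_epsilon)
    fix e :: real assume "e > 0"
    \<comment> \<open>The integral \<open>N\<close> of the modulus may be 0, hence the denominator
      \<open>N + 1\<close>.\<close>
    then have "cmod (integral torus_box (\<lambda>y. W y * cnj (W y))) \<le> e / (N + 1) * N"
      using N0 by (intro small) auto
    also have "\<dots> \<le> e"
      using N0 \<open>e > 0\<close> by (simp add: field_simps)
    finally show "cmod (integral torus_box (\<lambda>y. W y * cnj (W y))) \<le> 0 + e"
      by simp
  qed
  then have "integral torus_box (\<lambda>y. complex_of_real ((cmod (W y))\<^sup>2)) = 0"
    unfolding complex_norm_square by simp
  moreover have sq: "(\<lambda>y. (cmod (W y))\<^sup>2) integrable_on torus_box"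
    by (intro integrable_continuous continuous_intros contW)
  ultimately have "integral torus_box (\<lambda>y. (cmod (W y))\<^sup>2) = 0"
    using integral_linear[OF sq bounded_linear_of_real[where 'a = complex]] by (simp add: o_def)
  then have zero: "((\<lambda>y. (cmod (W y))\<^sup>2) has_integral 0) torus_box"
    using sq by (metis has_integral_integral)
  \<comment> \<open>The integral controls \<open>W\<close> only on the box, so the point is first
    moved there by periods.\<close>
  obtain y' where y': "y' \<in> torus_box" "W y' = W y"
    using torus_representative[OF W] by blast
  have "(cmod (W y'))\<^sup>2 = 0"
    by (rule has_integral_0_cbox_imp_0[OF _ _ zero])
       (use y' in \<open>auto intro!: continuous_intros contW simp: box_ne_empty Basis_vec_def inner_axis\<close>)
  then show ?thesis
    using y' by simp
qed

text \<open>By the Weierstrass test the series converges uniformly to a continuous \<open>V\<close>.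
  Integrating term by term gives \<open>V\<close> the coefficients of \<open>U\<close>, and
  uniqueness applied to the difference identifies the two.\<close>

lemma fourier_inversion:
  fixes U :: "real^'n \<Rightarrow> complex"
  assumes U: "continuous_on_torus U" and summable: "(\<lambda>k. cmod (fourier_coeff U k)) summable_on UNIV"
  shows "((\<lambda>k. fourier_coeff U k * phi k y) has_sum U y) UNIV"
proof -
  define F where "F = (finite_subsets_at_top UNIV :: (int^'n) set filter)"
  define V where "V y = (\<Sum>\<^sub>\<infinity>k. fourier_coeff U k * phi k y)" for y
  have lim: "uniform_limit UNIV (\<lambda>X y. \<Sum>k\<in>X. fourier_coeff U k * phi k y) V F"
    unfolding F_def V_def
    by (rule Weierstrass_m_test_general[where M = "\<lambda>k. cmod (fourier_coeff U k)"])
       (use summable in \<open>auto simp: norm_mult\<close>)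
  have nb: "F \<noteq> bot"
    by (simp add: F_def)
  have contV: "continuous_on UNIV V"
    by (rule uniform_limit_theorem[OF _ lim nb])
       (auto intro!: always_eventually continuous_intros)
  have V: "continuous_on_torus V"
    using contV by (simp add: continuous_on_torus_def V_def phi_periodic)
  have contU: "continuous_on UNIV U"
    using U by (simp add: continuous_on_torus_def)
  have coeffV: "fourier_coeff V l = fourier_coeff U l" for l
  proof -
    let ?p = "\<lambda>X y. (\<Sum>k\<in>X. fourier_coeff U k * phi k y) * phi (- l) y"
    have "uniform_limit torus_box ?p (\<lambda>y. V y * phi (- l) y) F"
    proof (rule uniform_lim_mult)
      show "uniform_limit torus_box (\<lambda>X y. \<Sum>k\<in>X. fourier_coeff U k * phi k y) V F"
        by (rule uniform_limit_on_subset[OF lim]) simp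
      show "bounded (V ` torus_box)"
        by (intro compact_imp_bounded compact_continuous_image compact_cbox
              continuous_on_subset[OF contV] subset_UNIV)
      show "bounded (phi (- l) ` torus_box)"
        by (auto intro!: boundedI[where B = 1])
    qed (rule uniform_limit_const)
    then obtain I J where I: "\<And>X. (?p X has_integral I X) torus_box"
      and J: "((\<lambda>y. V y * phi (- l) y) has_integral J) torus_box" and IJ: "(I \<longlongrightarrow> J) F"
      by (rule uniform_limit_integral_cbox) (use nb in \<open>auto intro!: continuous_intros\<close>)
    let ?c = "complex_of_real (1 / (2 * pi) ^ CARD('n))"
    \<comment> \<open>Once a partial sum contains the index \<open>l\<close>, its coefficient at
      \<open>l\<close> is exactly that of \<open>U\<close>; the limit is that of an eventually
      constant net.\<close>
    have "eventually (\<lambda>X. ?c * I X = fourier_coeff U l) F"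
      unfolding F_def eventually_finite_subsets_at_top
    proof (intro exI[of _ "{l}"] conjI allI impI)
      fix X :: "(int^'n) set" assume X: "finite X \<and> {l} \<subseteq> X \<and> X \<subseteq> UNIV"
      have "?c * I X = fourier_coeff (\<lambda>y. \<Sum>k\<in>X. fourier_coeff U k * phi k y) l"
        using I[of X] by (simp add: fourier_coeff_alt integral_unique)
      also have "\<dots> = fourier_coeff U l"
        using X by (subst fourier_coeff_trig_sum) auto
      finally show "?c * I X = fourier_coeff U l" .
    qed auto
    moreover have "((\<lambda>X. ?c * I X) \<longlongrightarrow> ?c * J) F"
      by (intro tendsto_intros IJ)
    ultimately have "fourier_coeff U l = ?c * J"
      by (intro tendsto_unique[OF nb tendsto_eventually])
    then show ?thesis
      using J by (simp add: fourier_coeff_alt integral_unique)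
  qed
  have "(\<lambda>y. U y - V y) y = 0"
  proof (rule fourier_unique_zero)
    show "continuous_on_torus (\<lambda>y. U y - V y)"
      using U V by (auto simp: continuous_on_torus_def intro!: continuous_intros)
    show "fourier_coeff (\<lambda>y. U y - V y) k = 0" for k
      using fourier_coeff_diff[OF contU contV] coeffV by simp
  qed
  moreover have "(\<lambda>k. fourier_coeff U k * phi k y) summable_on UNIV"
    by (rule abs_summable_summable) (use summable in \<open>simp add: norm_mult\<close>)
  ultimately show ?thesis
    by (simp add: V_def has_sum_infsum)
qed

section \<open>Aliasing\<close>

lemma has_sum_sum:
  fixes f :: "'a \<Rightarrow> 'b \<Rightarrow> 'c::topological_comm_monoid_add"
  assumes "\<And>i. i \<in> I \<Longrightarrow> (f i has_sum s i) A"
  shows "((\<lambda>x. \<Sum>i\<in>I. f i x) has_sum (\<Sum>i\<in>I. s i)) A"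
  using assms
  by (induction I rule: infinite_finite_induct) (auto intro: has_sum_add)

text \<open>A geometric sum over the powers of \<open>exp (i pi m / M)\<close>, a root of unity of
  order dividing \<open>2 M\<close>, which equals 1 precisely when \<open>2 M\<close> divides
  \<open>m\<close>.\<close>

lemma sum_roots_of_unity:
  fixes M :: nat and m :: int
  assumes "M > 0"
  shows "(\<Sum>l\<in>{0..<2 * int M}. exp (\<i> * complex_of_real (real_of_int m * (pi * real_of_int l / real M)))) =
    (if 2 * int M dvd m then of_nat (2 * M) else 0)"
proof -
  define z where "z = exp (\<i> * complex_of_real (real_of_int m * pi / real M))"
  have z1: "z = 1 \<longleftrightarrow> 2 * int M dvd m"
  proof -
    have "z = 1 \<longleftrightarrow> (\<exists>n::int. real_of_int m * pi / real M = real_of_int (2 * n) * pi)"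
      by (simp add: z_def exp_eq_1)
    also have "\<dots> \<longleftrightarrow> (\<exists>n. m = 2 * int M * n)"
    proof (rule arg_cong[where f = Ex], rule ext)
      fix n :: int
      have "real_of_int m * pi / real M = real_of_int (2 * n) * pi \<longleftrightarrow>
          real_of_int m = real_of_int (2 * int M * n)"
        using assms by (auto simp: field_simps)
      then show "(real_of_int m * pi / real M = real_of_int (2 * n) * pi) = (m = 2 * int M * n)"
        by (simp only: of_int_eq_iff)
    qed
    finally show ?thesis
      by (simp add: dvd_def)
  qed
  have zM: "z ^ (2 * M) = 1"
    using exp_int_2pi[of m] assms by (simp add: z_def exp_of_nat_mult[symmetric] field_simps)
  have "(\<Sum>l\<in>{0..<2 * int M}. exp (\<i> * complex_of_real (real_of_int m * (pi * real_of_int l / real M)))) =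
      (\<Sum>l<2 * M. z ^ l)"
    by (rule sum.reindex_bij_witness[where i = int and j = nat])
       (auto simp: z_def exp_of_nat_mult[symmetric] mult_ac)
  also have "\<dots> = (if 2 * int M dvd m then of_nat (2 * M) else 0)"
    using geometric_sum[of z "2 * M"] zM z1 by auto
  finally show ?thesis .
qed

text \<open>Discrete orthogonality: the grid is a product, so the sum splits into sums over roots of
  unity, one for each coordinate. The nonzero value is the number of grid points.\<close>

lemma sum_grid_phi:
  fixes emb :: "'d::finite \<Rightarrow> 'n::finite"
  assumes "inj emb" "K > 0" "L > 0"
  shows "(\<Sum>y\<in>grid emb K L. phi m y) =
    (if \<forall>j. 2 * int (if j \<in> range emb then K else L) dvd m $ j
     then of_real (2 ^ CARD('n) * real K ^ CARD('d) * real L ^ (CARD('n) - CARD('d))) else 0)"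
proof -
  define M where "M j = (if j \<in> range emb then K else L)" for j
  have M0: "M j > 0" for j
    using assms by (simp add: M_def)
  let ?pt = "\<lambda>l :: int^'n. (\<chi> j. pi * real_of_int (l $ j) / real (M j)) :: real^'n"
  have grid: "grid emb K L = ?pt ` {l. \<forall>j. l $ j \<in> {0..<2 * int (M j)}}"
    unfolding grid_def M_def by (auto simp: if_distrib cong: if_cong)
  have inj: "inj_on ?pt X" for X
  proof (rule inj_onI)
    fix l l' assume "?pt l = ?pt l'"
    then have "pi * real_of_int (l $ j) / real (M j) = pi * real_of_int (l' $ j) / real (M j)" for j
      by (simp add: vec_eq_iff)
    moreover have "M j \<noteq> 0" for j
      using M0[of j] by simp
    ultimately show "l = l'"
      by (simp add: vec_eq_iff)
  qed
  have "(\<Sum>y\<in>grid emb K L. phi m y) = (\<Sum>l\<in>{l. \<forall>j. l $ j \<in> {0..<2 * int (M j)}}. phi m (?pt l))"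
    unfolding grid by (subst sum.reindex[OF inj]) simp
  also have "\<dots> = (\<Sum>l\<in>{l. \<forall>j. l $ j \<in> {0..<2 * int (M j)}}.
      \<Prod>j\<in>UNIV. exp (\<i> * complex_of_real (real_of_int (m $ j) * (pi * real_of_int (l $ j) / real (M j)))))"
    by (simp add: phi_prod)
  also have "\<dots> = (\<Prod>j\<in>UNIV. \<Sum>l\<in>{0..<2 * int (M j)}.
      exp (\<i> * complex_of_real (real_of_int (m $ j) * (pi * real_of_int l / real (M j)))))"
    by (rule sum_vec_prod) simp
  also have "\<dots> = (\<Prod>j\<in>UNIV. if 2 * int (M j) dvd m $ j then of_nat (2 * M j) else 0)"
    by (rule prod.cong) (use sum_roots_of_unity[OF M0] in auto)
  also have "\<dots> = (if \<forall>j. 2 * int (M j) dvd m $ j then of_nat (\<Prod>j\<in>UNIV. 2 * M j) else 0)"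
    by auto
  also have "(\<Prod>j\<in>UNIV. 2 * M j) = 2 ^ CARD('n) * K ^ CARD('d) * L ^ (CARD('n) - CARD('d))"
  proof -
    have "(\<Prod>j\<in>UNIV. M j) = K ^ card (range emb) * L ^ card (- range emb)"
      by (simp add: M_def prod.If_cases)
    then show ?thesis
      using assms(1) by (simp add: prod.distrib card_image Compl_eq_Diff_UNIV card_Diff_subset)
  qed
  finally show ?thesis
    by (simp add: M_def)
qed

definition alias_class :: "('d \<Rightarrow> 'n) \<Rightarrow> nat \<Rightarrow> nat \<Rightarrow> int^'n \<Rightarrow> (int^'n) set" where
  "alias_class emb K L k = {m. \<forall>j. 2 * int (if j \<in> range emb then K else L) dvd m $ j - k $ j}"

text \<open>The Fourier series is inserted at each of the finitely many grid points. Exchanging the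
  finite sum with the series leaves the grid sum of \<open>phi (m - k)\<close>, which selects the
  indices congruent to \<open>k\<close>.\<close>

lemma discrete_coeff_has_sum:
  fixes emb :: "'d::finite \<Rightarrow> 'n::finite"
  assumes emb: "inj emb" and KL: "K > 0" "L > 0" and U: "continuous_on_torus U"
    and summable: "(\<lambda>k. cmod (fourier_coeff U k)) summable_on UNIV"
  shows "(fourier_coeff U has_sum discrete_coeff emb K L U k) (alias_class emb K L k)"
proof -
  define N where "N = 2 ^ CARD('n) * real K ^ CARD('d) * real L ^ (CARD('n) - CARD('d))"
  have N: "N > 0"
    using KL by (simp add: N_def)
  have "((\<lambda>m. \<Sum>y\<in>grid emb K L. fourier_coeff U m * phi m y * cnj (phi k y)) has_sum
      (\<Sum>y\<in>grid emb K L. U y * cnj (phi k y))) UNIV"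
    by (intro has_sum_sum has_sum_cmult_left fourier_inversion U summable)
  then have "((\<lambda>m. complex_of_real (1 / N) * (\<Sum>y\<in>grid emb K L. fourier_coeff U m * phi m y * cnj (phi k y)))
      has_sum discrete_coeff emb K L U k) UNIV"
    unfolding discrete_coeff_def N_def by (rule has_sum_cmult_right)
  moreover have "complex_of_real (1 / N) * (\<Sum>y\<in>grid emb K L. fourier_coeff U m * phi m y * cnj (phi k y)) =
      (if m \<in> alias_class emb K L k then fourier_coeff U m else 0)" for m
  proof -
    have "(\<Sum>y\<in>grid emb K L. fourier_coeff U m * phi m y * cnj (phi k y)) =
        fourier_coeff U m * (\<Sum>y\<in>grid emb K L. phi (m - k) y)"
      by (simp add: cnj_phi phi_mult sum_distrib_left mult.assoc)
    also have "\<dots> = fourier_coeff U m * (if m \<in> alias_class emb K L k then of_real N else 0)"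
      by (subst sum_grid_phi[OF emb KL]) (simp add: alias_class_def N_def)
    finally show ?thesis
      using N by simp
  qed
  ultimately have "((\<lambda>m. if m \<in> alias_class emb K L k then fourier_coeff U m else 0)
      has_sum discrete_coeff emb K L U k) UNIV"
    by simp
  then show ?thesis
    by (subst has_sum_cong_neutral[where T = UNIV]) auto
qed

section \<open>The parent function\<close>

text \<open>Rational independence of the columns gives \<open>P k \<noteq> 0\<close> for every
  nonzero integer vector \<open>k\<close>. The vectors \<open>x\<close> orthogonal to one such
  \<open>P k\<close> form a null set, and countably many null sets do not cover the space. This
  reduces density of a d-dimensional image in the torus to density of a single line.\<close>

lemma projection_matrix_generic_direction:
  fixes P :: "real^'n^'d"
  assumes P: "P \<in> projection_matrices"
  obtains x where "\<And>c :: int^'n. c \<noteq> 0 \<Longrightarrow> (P *v real_vec c) \<bullet> x \<noteq> 0"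
proof -
  have nz: "P *v real_vec c \<noteq> 0" if "c \<noteq> 0" for c :: "int^'n"
  proof
    assume "P *v real_vec c = 0"
    then have "(\<Sum>j\<in>UNIV. of_rat (of_int (c $ j)) *\<^sub>R column j P) = 0"
      by (simp add: matrix_mult_sum scalar_mult_eq_scaleR)
    then have "\<forall>j. (of_int (c $ j) :: rat) = 0"
      using P unfolding projection_matrices_def
      by (auto dest!: spec[where x = "\<lambda>j. of_int (c $ j)"])
    then show False
      using that by (simp add: vec_eq_iff)
  qed
  have "negligible (\<Union>c\<in>- {0 :: int^'n}. {x. (P *v real_vec c) \<bullet> x = 0})"
    by (rule negligible_countable_Union) (auto intro!: negligible_hyperplane simp: nz)
  then have "(\<Union>c\<in>- {0 :: int^'n}. {x. (P *v real_vec c) \<bullet> x = 0}) \<noteq> UNIV"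
    using non_negligible_UNIV by metis
  then show ?thesis
    using that by blast
qed

text \<open>Along a generic direction \<open>x0\<close> the components of the transpose of
  \<open>P\<close> applied to \<open>x0\<close> satisfy no integer relation, which is the hypothesis
  of Kronecker's approximation theorem. The factor \<open>2 * pi\<close> is divided out because that
  theorem works modulo 1.\<close>

lemma dense_line_in_torus:
  fixes P :: "real^'n^'d"
  assumes P: "P \<in> projection_matrices" and "e > 0"
  obtains x h where "\<And>j. \<bar>(transpose P *v x) $ j - 2 * pi * real_of_int (h $ j) - y $ j\<bar> < e"
proof -
  obtain x0 where x0: "\<And>c :: int^'n. c \<noteq> 0 \<Longrightarrow> (P *v real_vec c) \<bullet> x0 \<noteq> 0"
    using projection_matrix_generic_direction[OF P] by metis
  define \<psi> where "\<psi> j = (transpose P *v x0) $ j / (2 * pi)" for j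
  have indep: "c = 0" if "(\<Sum>j\<in>UNIV. real_of_int (c $ j) * \<psi> j) = 0" for c
  proof -
    have "(P *v real_vec c) \<bullet> x0 = real_vec c \<bullet> (transpose P *v x0)"
      by (simp add: dot_lmul_matrix[symmetric] inner_commute)
    also have "\<dots> = 2 * pi * (\<Sum>j\<in>UNIV. real_of_int (c $ j) * \<psi> j)"
      by (simp add: inner_vec_def \<psi>_def sum_divide_distrib[symmetric])
    finally show ?thesis
      using that x0[of c] by auto
  qed
  have inj: "inj \<psi>"
  proof (rule injI)
    fix i j assume ij: "\<psi> i = \<psi> j"
    \<comment> \<open>Two equal components would be an integer relation with coefficients 1 and
      -1.\<close>
    have "(\<Sum>l\<in>UNIV. real_of_int ((axis i 1 - axis j 1 :: int^'n) $ l) * \<psi> l) = \<psi> i - \<psi> j"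
      by (simp add: axis_def left_diff_distrib sum_subtractf if_distrib[of real_of_int]
            if_distrib[of "\<lambda>x. x * _"] cong: if_cong)
    then have "axis i 1 - axis j 1 = (0 :: int^'n)"
      using ij by (intro indep) simp
    then show "i = j"
      by (simp add: axis_eq_axis)
  qed
  \<comment> \<open>The theorem of Kronecker takes a family indexed by natural numbers, with
    independence of its set of values and injectivity as separate hypotheses.\<close>
  obtain e' where e': "bij_betw e' {..<CARD('n)} (UNIV :: 'n set)"
    using ex_bij_betw_nat_finite[of "UNIV :: 'n set"] by (auto simp: atLeast0LessThan)
  have range: "(\<lambda>i. \<psi> (e' i)) ` {..<CARD('n)} = range \<psi>"
    using e' by (metis bij_betw_imp_surj_on image_image)
  interpret M: Modules.module "\<lambda>r. (*) (real_of_int r)"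
    by (simp add: Modules.module.intro distrib_left mult.commute)
  have "M.independent ((\<lambda>i. \<psi> (e' i)) ` {..<CARD('n)})"
    unfolding range M.independent_explicit_module
  proof (intro allI impI)
    fix t u v assume t: "finite t" "t \<subseteq> range \<psi>" and sum: "(\<Sum>v\<in>t. real_of_int (u v) * v) = 0"
      and v: "v \<in> t"
    define c :: "int^'n" where "c = (\<chi> j. if \<psi> j \<in> t then u (\<psi> j) else 0)"
    have "(\<Sum>j\<in>UNIV. real_of_int (c $ j) * \<psi> j) = (\<Sum>j\<in>\<psi> -` t. real_of_int (u (\<psi> j)) * \<psi> j)"
      by (rule sum.mono_neutral_cong_right) (auto simp: c_def)
    also have "\<dots> = (\<Sum>v\<in>\<psi> ` (\<psi> -` t). real_of_int (u v) * v)"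
      using inj by (subst sum.reindex) (auto intro: inj_on_subset)
    also have "\<psi> ` (\<psi> -` t) = t"
      using t by auto
    finally have "c = 0"
      using sum by (intro indep) simp
    moreover obtain j where "v = \<psi> j"
      using t v by blast
    ultimately show "u v = 0"
      using v by (auto simp: c_def vec_eq_iff dest!: spec[where x = j])
  qed
  moreover have "inj_on (\<lambda>i. \<psi> (e' i)) {..<CARD('n)}"
    using e' inj by (auto simp: inj_on_def bij_betw_def)
  ultimately obtain t h where th: "\<And>i. i < CARD('n) \<Longrightarrow>
      \<bar>t * \<psi> (e' i) - of_int (h i) - y $ e' i / (2 * pi)\<bar> < e / (2 * pi)"
    by (rule Kronecker_thm_1[where \<epsilon> = "e / (2 * pi)" and \<alpha> = "\<lambda>i. y $ e' i / (2 * pi)"])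
       (use \<open>e > 0\<close> in auto)
  define h' where "h' = (\<chi> j. h (inv_into {..<CARD('n)} e' j))"
  show ?thesis
  proof (rule that[of "t *\<^sub>R x0" h'])
    fix j
    let ?i = "inv_into {..<CARD('n)} e' j"
    have i: "?i < CARD('n)" "e' ?i = j"
      using e' by (auto simp: bij_betw_def f_inv_into_f intro: inv_into_into[where A = "{..<CARD('n)}", simplified])
    have eq: "(transpose P *v (t *\<^sub>R x0)) $ j - 2 * pi * real_of_int (h' $ j) - y $ j =
        2 * pi * (t * \<psi> j - of_int (h ?i) - y $ j / (2 * pi))"
      by (simp add: \<psi>_def h'_def matrix_vector_mult_scaleR field_simps)
    have "2 * pi * \<bar>t * \<psi> j - of_int (h ?i) - y $ j / (2 * pi)\<bar> < e"
      using th[OF i(1)] unfolding i(2) by (simp add: pos_less_divide_eq mult.commute)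
    then show "\<bar>(transpose P *v (t *\<^sub>R x0)) $ j - 2 * pi * real_of_int (h' $ j) - y $ j\<bar> < e"
      unfolding eq by (simp add: abs_mult)
  qed
qed

text \<open>The difference of two parents vanishes on the image of the transpose of \<open>P\<close>
  and, by periodicity, on all its translates by periods. This set is dense, and the zero set of a
  continuous function is closed.\<close>

lemma is_parent_unique:
  fixes P :: "real^'n^'d"
  assumes P: "P \<in> projection_matrices" and U: "is_parent P U u" and V: "is_parent P V u"
  shows "U = V"
proof
  fix y
  define W where "W y = U y - V y" for y
  have W: "continuous_on_torus W"
    using U V by (auto simp: continuous_on_torus_def is_parent_def W_def intro!: continuous_intros)
  have W0: "W (transpose P *v x) = 0" for x
    using U V by (metis W_def is_parent_def right_minus_eq)
  have "y \<in> closure (W -` {0})"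
    unfolding closure_approachable
  proof (intro allI impI)
    fix e :: real assume "e > 0"
    then have "e / real CARD('n) > 0"
      by simp
    then obtain x h where xh: "\<And>j. \<bar>(transpose P *v x) $ j - 2 * pi * real_of_int (h $ j) - y $ j\<bar> < e / real CARD('n)"
      using dense_line_in_torus[OF P] by metis
    define y' where "y' = transpose P *v x + (2 * pi) *\<^sub>R real_vec (- h)"
    have "W y' = 0"
      unfolding y'_def torus_periodic[OF W] by (rule W0)
    moreover have "dist y' y < e"
    proof -
      have "dist y' y \<le> (\<Sum>j\<in>UNIV. \<bar>(y' - y) $ j\<bar>)"
        unfolding dist_norm by (rule norm_le_l1_cart)
      also have "\<dots> < (\<Sum>j\<in>(UNIV :: 'n set). e / real CARD('n))"
        using xh by (intro sum_strict_mono) (auto simp: y'_def)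
      finally show ?thesis
        by simp
    qed
    ultimately show "\<exists>y'\<in>W -` {0}. dist y' y < e"
      by blast
  qed
  moreover have "closed (W -` {0})"
    using W by (intro continuous_closed_vimage) (auto simp: continuous_on_torus_def continuous_on_eq_continuous_at)
  ultimately show "U y = V y"
    by (simp add: W_def)
qed

lemma parent_eq:
  assumes "P \<in> projection_matrices" "is_parent P U u"
  shows "parent P u = U"
  unfolding parent_def using assms is_parent_unique by blast

section \<open>Lattice sums\<close>

lemma summable_on_int_powr:
  fixes p :: real
  assumes "p > 1"
  shows "(\<lambda>x::int. if x = 0 then 1 else \<bar>real_of_int x\<bar> powr (- p)) summable_on UNIV"
proof -
  let ?f = "\<lambda>x::int. if x = 0 then 1 else \<bar>real_of_int x\<bar> powr (- p)"
  \<comment> \<open>Since \<open>0 powr (- p) = 0\<close>, the extra term supplies the value 1 at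
    the origin.\<close>
  have "summable (\<lambda>n. real n powr (- p) + (if n = 0 then 1 else 0))"
    using assms by (intro summable_add) (auto simp: summable_real_powr_iff)
  then have "summable (\<lambda>n. ?f (int n))"
    by (rule summable_cong[THEN iffD1, rotated]) (auto intro!: always_eventually)
  then have nat: "(\<lambda>n. ?f (int n)) summable_on UNIV"
    by (rule summable_nonneg_imp_summable_on) auto
  have "?f summable_on range int"
    by (subst summable_on_reindex) (use nat in \<open>auto simp: o_def\<close>)
  moreover have "?f summable_on range (\<lambda>n. - int (Suc n))"
  proof (subst summable_on_reindex)
    have "(\<lambda>n. ?f (int n)) summable_on range Suc"
      by (rule summable_on_subset_banach[OF nat]) simp
    then show "(?f \<circ> (\<lambda>n. - int (Suc n))) summable_on UNIV"
      by (subst (asm) summable_on_reindex) (auto simp: o_def add_ac)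
  qed (auto simp: inj_on_def)
  ultimately have "?f summable_on (range int \<union> range (\<lambda>n. - int (Suc n)))"
    by (rule summable_on_Un_disjoint) auto
  moreover have "range int \<union> range (\<lambda>n. - int (Suc n)) = UNIV"
  proof -
    have "x \<in> range int \<union> range (\<lambda>n. - int (Suc n))" for x
      by (cases x rule: int_cases) auto
    then show ?thesis
      by blast
  qed
  ultimately show ?thesis
    by simp
qed

text \<open>The weight of the seminorm with the coupling \<open>Q\<close> removed, meant for cell
  indices. For positive exponents plain \<open>powr\<close> agrees with \<open>rpow\<close>.\<close>

definition lattice_weight :: "('d::finite \<Rightarrow> 'n::finite) \<Rightarrow> real \<Rightarrow> real \<Rightarrow> int^'n \<Rightarrow> real" where
  "lattice_weight emb \<alpha> \<beta> r = norm (part1 emb r) powr (2 * \<alpha>) + norm (part2 emb r) powr (2 * \<beta>)"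

lemma lattice_weight_ge:
  fixes emb :: "'d::finite \<Rightarrow> 'n::finite"
  assumes "\<alpha> > 0" "\<beta> > 0"
  shows "\<bar>real_of_int (r $ j)\<bar> powr (if j \<in> range emb then 2 * \<alpha> else 2 * \<beta>) \<le> lattice_weight emb \<alpha> \<beta> r"
proof (cases "j \<in> range emb")
  case True
  then obtain i where i: "j = emb i" by blast
  have "\<bar>real_of_int (r $ j)\<bar> \<le> norm (part1 emb r)"
    using component_le_norm_cart[of "part1 emb r" i] by (simp add: part1_def i)
  then have "\<bar>real_of_int (r $ j)\<bar> powr (2 * \<alpha>) \<le> norm (part1 emb r) powr (2 * \<alpha>)"
    using assms by (intro powr_mono2) auto
  then show ?thesis
    using True by (simp add: lattice_weight_def add_increasing2)
next
  case False
  have "\<bar>real_of_int (r $ j)\<bar> \<le> norm (part2 emb r)"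
    using component_le_norm_cart[of "part2 emb r" j] False by (simp add: part2_def)
  then have "\<bar>real_of_int (r $ j)\<bar> powr (2 * \<beta>) \<le> norm (part2 emb r) powr (2 * \<beta>)"
    using assms by (intro powr_mono2) auto
  then show ?thesis
    using False by (simp add: lattice_weight_def add_increasing)
qed

lemma lattice_weight_ge_1:
  fixes emb :: "'d::finite \<Rightarrow> 'n::finite"
  assumes "\<alpha> > 0" "\<beta> > 0" "r \<noteq> 0"
  shows "lattice_weight emb \<alpha> \<beta> r \<ge> 1"
proof -
  obtain j where "r $ j \<noteq> 0"
    using assms(3) by (auto simp: vec_eq_iff)
  then have "\<bar>real_of_int (r $ j)\<bar> \<ge> 1"
    by linarith
  then have "\<bar>real_of_int (r $ j)\<bar> powr (if j \<in> range emb then 2 * \<alpha> else 2 * \<beta>) \<ge> 1"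
    using assms by (intro ge_one_powr_ge_zero) auto
  then show ?thesis
    using lattice_weight_ge[OF assms(1,2), of r j emb] by linarith
qed

text \<open>Let \<open>s\<^sub>j\<close> be the exponent of coordinate \<open>j\<close> and \<open>p = 1 / (\<Sum>j. 1 / s\<^sub>j) > 1\<close>. As the exponents \<open>p / s\<^sub>j\<close>
  add up to 1, \<open>X = 1 + lattice_weight r\<close> is the product of the \<open>X powr (p / s\<^sub>j) \<ge> \<bar>r\<^sub>j\<bar> powr p\<close>, and the
  sum is dominated by a product of convergent one-dimensional sums.\<close>

lemma lattice_sum_bounded:
  fixes emb :: "'d::finite \<Rightarrow> 'n::finite"
  assumes emb: "inj emb" and \<alpha>: "\<alpha> > 0" and \<beta>: "\<beta> > 0"
    and lt1: "real CARD('d) / (2 * \<alpha>) + (real CARD('n) - real CARD('d)) / (2 * \<beta>) < 1"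
  obtains S where "S > 0"
    and "\<And>F. finite F \<Longrightarrow> 0 \<notin> F \<Longrightarrow> (\<Sum>r\<in>F. 1 / lattice_weight emb \<alpha> \<beta> r) \<le> S"
proof -
  define s where "s j = (if j \<in> range emb then 2 * \<alpha> else 2 * \<beta>)" for j
  define \<sigma> where "\<sigma> = (\<Sum>j\<in>UNIV. 1 / s j)"
  define p where "p = 1 / \<sigma>"
  have s0: "s j > 0" for j
    using \<alpha> \<beta> by (simp add: s_def)
  have "\<sigma> = real (card (range emb)) * (1 / (2 * \<alpha>)) + real (card (- range emb)) * (1 / (2 * \<beta>))"
    unfolding \<sigma>_def s_def by (simp add: if_distrib sum.If_cases cong: if_cong)
  also have "\<dots> = real CARD('d) / (2 * \<alpha>) + (real CARD('n) - real CARD('d)) / (2 * \<beta>)"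
  proof -
    have "card (range emb) = CARD('d)" "CARD('d) \<le> CARD('n)"
      using emb by (auto simp: card_image intro: card_inj_on_le[of emb])
    then show ?thesis
      by (simp add: Compl_eq_Diff_UNIV card_Diff_subset of_nat_diff)
  qed
  finally have "\<sigma> < 1"
    using lt1 by simp
  have "\<sigma> > 0"
    unfolding \<sigma>_def using s0 by (intro sum_pos) auto
  have p1: "p > 1"
    using \<open>\<sigma> < 1\<close> \<open>\<sigma> > 0\<close> by (simp add: p_def)
  have ps: "(\<Sum>j\<in>UNIV. p / s j) = 1"
  proof -
    have "(\<Sum>j\<in>UNIV. p / s j) = p * \<sigma>"
      by (simp add: \<sigma>_def sum_distrib_left)
    then show ?thesis
      using \<open>\<sigma> > 0\<close> by (simp add: p_def)
  qed
  define g where "g x = (if x = 0 then 1 else \<bar>real_of_int x\<bar> powr (- p))" for x :: int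
  have g: "g summable_on UNIV"
    unfolding g_def by (rule summable_on_int_powr[OF p1])
  have g0: "g x \<ge> 0" for x
    by (simp add: g_def)
  have pointwise: "1 / lattice_weight emb \<alpha> \<beta> r \<le> 2 * (\<Prod>j\<in>UNIV. g (r $ j))" if "r \<noteq> 0" for r
  proof -
    \<comment> \<open>The summand 1 keeps \<open>X \<ge> 1\<close>, so that a vanishing coordinate
      contributes a factor at most \<open>1 = g 0\<close>. As the lattice weight is at least 1, the
      price is the factor 2.\<close>
    define X where "X = 1 + lattice_weight emb \<alpha> \<beta> r"
    have ge1: "lattice_weight emb \<alpha> \<beta> r \<ge> 1"
      by (rule lattice_weight_ge_1[OF \<alpha> \<beta> that])
    have gX: "X powr (- (p / s j)) \<le> g (r $ j)" for j
    proof (cases "r $ j = 0")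
      case True
      have "X powr (- (p / s j)) \<le> X powr 0"
        using ge1 p1 s0[of j] by (intro powr_mono) (auto simp: X_def)
      then show ?thesis
        using True ge1 by (simp add: g_def X_def)
    next
      case False
      have "\<bar>real_of_int (r $ j)\<bar> powr s j \<le> X"
        using lattice_weight_ge[OF \<alpha> \<beta>, of r j emb] by (simp add: s_def X_def)
      then have "X powr (- (p / s j)) \<le> (\<bar>real_of_int (r $ j)\<bar> powr s j) powr (- (p / s j))"
        using False p1 s0[of j] by (intro powr_mono2') auto
      also have "\<dots> = g (r $ j)"
        using False s0[of j] by (simp add: g_def powr_powr)
      finally show ?thesis .
    qed
    have "X powr (- 1) = X powr (\<Sum>j\<in>UNIV. - (p / s j))"
      by (simp add: sum_negf ps)
    also have "\<dots> = (\<Prod>j\<in>UNIV. X powr (- (p / s j)))"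
      using ge1 by (subst powr_sum) (auto simp: X_def)
    also have "\<dots> \<le> (\<Prod>j\<in>UNIV. g (r $ j))"
      by (rule prod_mono) (use gX in auto)
    finally have "1 / X \<le> (\<Prod>j\<in>UNIV. g (r $ j))"
      using ge1 by (simp add: powr_minus_divide X_def)
    moreover have "1 / lattice_weight emb \<alpha> \<beta> r \<le> 2 * (1 / X)"
      using ge1 by (simp add: X_def field_simps)
    ultimately show ?thesis
      by linarith
  qed
  \<comment> \<open>The final \<open>+ 1\<close> only secures strict positivity.\<close>
  define S where "S = 2 * (infsum g UNIV) ^ CARD('n) + 1"
  have bound: "(\<Sum>r\<in>F. 1 / lattice_weight emb \<alpha> \<beta> r) \<le> S" if F: "finite F" "0 \<notin> F" for F
  proof -
    \<comment> \<open>The finite set is enlarged to the product of its coordinate projections, over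
      which the sum of products factors.\<close>
    define B where "B j = (\<lambda>r. r $ j) ` F" for j
    have B: "finite (B j)" for j
      using F by (simp add: B_def)
    have "(\<Sum>r\<in>F. 1 / lattice_weight emb \<alpha> \<beta> r) \<le> (\<Sum>r\<in>F. 2 * (\<Prod>j\<in>UNIV. g (r $ j)))"
      by (intro sum_mono pointwise) (use F in auto)
    also have "\<dots> \<le> (\<Sum>r\<in>{r. \<forall>j. r $ j \<in> B j}. 2 * (\<Prod>j\<in>UNIV. g (r $ j)))"
      by (intro sum_mono2 finite_vec_box B) (auto simp: B_def intro!: mult_nonneg_nonneg prod_nonneg g0)
    also have "\<dots> = 2 * (\<Prod>j\<in>UNIV. \<Sum>x\<in>B j. g x)"
      using sum_vec_prod[of B "\<lambda>j. g"] B by (simp add: sum_distrib_left[symmetric])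
    also have "\<dots> \<le> 2 * (\<Prod>j\<in>(UNIV :: 'n set). infsum g UNIV)"
      by (intro mult_left_mono prod_mono)
         (auto intro!: sum_nonneg g0 finite_sum_le_infsum g B)
    finally show ?thesis
      by (simp add: S_def)
  qed
  have "S > 0"
    using infsum_nonneg[of UNIV g] g0 by (simp add: S_def add_nonneg_pos)
  with bound show ?thesis
    using that by blast
qed

section \<open>Cells of the frequency lattice\<close>

definition weight :: "('d::finite \<Rightarrow> 'n::finite) \<Rightarrow> real^'n^'d \<Rightarrow> real \<Rightarrow> real \<Rightarrow> int^'n \<Rightarrow> real" where
  "weight emb P \<alpha> \<beta> k = rpow (norm (freq emb P k)) (2 * \<alpha>) + rpow (norm (part2 emb k)) (2 * \<beta>)"

lemma rpow_nonneg: "rpow x a \<ge> 0"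
  by (simp add: rpow_def)

lemma weight_nonneg: "weight emb P \<alpha> \<beta> k \<ge> 0"
  by (simp add: weight_def rpow_nonneg)

text \<open>The cell index of \<open>m\<close> is the translation vector, in units of \<open>(2K, 2L)\<close>, of the translate of
  \<open>[-K, K)\<^sup>d \<times> [-L, L)\<^sup>n\<^sup>-\<^sup>d\<close> that contains \<open>(m\<^sub>I + Q m\<^sub>I\<^sub>I, m\<^sub>I\<^sub>I)\<close>.\<close>

definition cell :: "('d::finite \<Rightarrow> 'n::finite) \<Rightarrow> real^'n^'d \<Rightarrow> real \<Rightarrow> real \<Rightarrow> int^'n \<Rightarrow> int^'n" where
  "cell emb P K L m = (\<chi> j. if j \<in> range emb
     then \<lfloor>(freq emb P m $ (inv emb j) + K) / (2 * K)\<rfloor>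
     else \<lfloor>(real_of_int (m $ j) + L) / (2 * L)\<rfloor>)"

lemma floor_cell_shift:
  assumes "M > (0::real)" "x = y + 2 * M * real_of_int z"
    and "\<lfloor>(x + M) / (2 * M)\<rfloor> = \<lfloor>(y + M) / (2 * M)\<rfloor>"
  shows "x = y"
proof -
  have "(x + M) / (2 * M) = (y + M) / (2 * M) + real_of_int z"
    using assms(1,2) by (simp add: field_simps)
  then have "z = 0"
    using assms(3) by simp
  then show ?thesis
    using assms(2) by simp
qed

text \<open>Block II is compared directly. Once it agrees, the \<open>Q\<close> terms of the two
  frequencies cancel, so their difference in block I is again a multiple of \<open>2 K\<close> and
  the same floor argument applies. The scales \<open>K\<close> and \<open>L\<close> are real so that
  cells of width one are covered as well.\<close>

lemma cell_inj:
  fixes emb :: "'d::finite \<Rightarrow> 'n::finite"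
  assumes emb: "inj emb" and KL: "K > 0" "L > 0"
    and cong: "\<And>j. \<exists>z. real_of_int (m $ j) = real_of_int (m' $ j) + 2 * (if j \<in> range emb then K else L) * real_of_int z"
    and cell: "cell emb P K L m = cell emb P K L m'"
  shows "m = m'"
proof -
  have cell_j: "cell emb P K L m $ j = cell emb P K L m' $ j" for j
    using cell by simp
  have II: "m $ j = m' $ j" if j: "j \<notin> range emb" for j
  proof -
    obtain z where z: "real_of_int (m $ j) = real_of_int (m' $ j) + 2 * L * real_of_int z"
      using cong[of j] unfolding if_not_P[OF j] by blast
    have "\<lfloor>(real_of_int (m $ j) + L) / (2 * L)\<rfloor> = \<lfloor>(real_of_int (m' $ j) + L) / (2 * L)\<rfloor>"
      using cell_j[of j] by (simp add: cell_def if_not_P[OF j])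
    from floor_cell_shift[OF KL(2) z this] show ?thesis
      by simp
  qed
  then have "part2 emb m = part2 emb m'"
    by (simp add: part2_def vec_eq_iff)
  then have diff: "freq emb P m $ i = freq emb P m' $ i + real_of_int (m $ emb i) - real_of_int (m' $ emb i)" for i
    by (simp add: freq_def part1_def)
  have I: "m $ emb i = m' $ emb i" for i
  proof -
    obtain z where "real_of_int (m $ emb i) = real_of_int (m' $ emb i) + 2 * K * real_of_int z"
      using cong[of "emb i"] unfolding if_P[OF rangeI] by blast
    then have z: "freq emb P m $ i = freq emb P m' $ i + 2 * K * real_of_int z"
      using diff[of i] by simp
    have "\<lfloor>(freq emb P m $ i + K) / (2 * K)\<rfloor> = \<lfloor>(freq emb P m' $ i + K) / (2 * K)\<rfloor>"
      using cell_j[of "emb i"] by (simp add: cell_def inv_f_f[OF emb])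
    from floor_cell_shift[OF KL(1) z this] show ?thesis
      using diff[of i] by simp
  qed
  show ?thesis
    unfolding vec_eq_iff using I II by (metis rangeE)
qed

text \<open>A point of cell \<open>r\<close> lies within \<open>M\<close> of the centre
  \<open>2 M r\<close>, and \<open>2 \<bar>r\<bar> - 1 \<ge> \<bar>r\<bar>\<close> for every nonzero
  integer \<open>r\<close>.\<close>

lemma floor_cell_abs_le:
  assumes "M > (0::real)"
  shows "M * \<bar>real_of_int \<lfloor>(x + M) / (2 * M)\<rfloor>\<bar> \<le> \<bar>x\<bar>"
proof -
  define r where "r = \<lfloor>(x + M) / (2 * M)\<rfloor>"
  have "real_of_int r \<le> (x + M) / (2 * M)" "(x + M) / (2 * M) < real_of_int r + 1"
    by (simp_all add: r_def)
  then have b: "2 * (M * real_of_int r) - M \<le> x" "x < 2 * (M * real_of_int r) + M"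
    using assms by (auto simp: field_simps)
  consider "r = 0" | "r \<ge> 1" | "r \<le> - 1"
    by linarith
  then have "M * \<bar>real_of_int r\<bar> \<le> \<bar>x\<bar>"
  proof cases
    case 2
    then have "M * 1 \<le> M * real_of_int r"
      using assms by (intro mult_left_mono) auto
    moreover have "M * \<bar>real_of_int r\<bar> = M * real_of_int r"
      using 2 by simp
    ultimately show ?thesis
      using b by linarith
  next
    case 3
    then have "M * real_of_int r \<le> M * (- 1)"
      using assms by (intro mult_left_mono) auto
    moreover have "M * \<bar>real_of_int r\<bar> = - (M * real_of_int r)"
      using 3 by simp
    ultimately show ?thesis
      using b by linarith
  qed auto
  then show ?thesis
    by (simp add: r_def)
qed

text \<open>Coordinate by coordinate, \<open>K\<close> or \<open>L\<close> times the cell index is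
  dominated by the frequency or by block II. The powers of \<open>K\<close> and \<open>L\<close>
  that this releases are the source of the convergence rate; the mixed products on the right are
  harmless nonnegative terms.\<close>

lemma lattice_weight_cell_le:
  fixes emb :: "'d::finite \<Rightarrow> 'n::finite"
  assumes emb: "inj emb" and \<alpha>\<beta>: "\<alpha> > 0" "\<beta> > 0" and KL: "K > 0" "L > 0"
  shows "lattice_weight emb \<alpha> \<beta> (cell emb P K L m) \<le>
    (K powr (- (2 * \<alpha>)) + L powr (- (2 * \<beta>))) * weight emb P \<alpha> \<beta> m"
proof -
  let ?r = "cell emb P K L m"
  have scale: "x powr (2 * a) \<le> M powr (- (2 * a)) * y powr (2 * a)"
    if "M > 0" "a > 0" "x \<ge> 0" "M * x \<le> y" for x y M a :: real
  proof -
    have "x powr (2 * a) = M powr (- (2 * a)) * (M * x) powr (2 * a)"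
      using that by (simp add: powr_mult powr_minus)
    also have "\<dots> \<le> M powr (- (2 * a)) * y powr (2 * a)"
      using that by (intro mult_left_mono powr_mono2) auto
    finally show ?thesis .
  qed
  have "norm (K *\<^sub>R part1 emb ?r) \<le> norm (freq emb P m)"
    using KL emb floor_cell_abs_le[OF KL(1)]
    by (intro norm_le_componentwise_cart) (simp add: part1_def cell_def abs_mult)
  then have 1: "norm (part1 emb ?r) powr (2 * \<alpha>) \<le> K powr (- (2 * \<alpha>)) * norm (freq emb P m) powr (2 * \<alpha>)"
    using KL \<alpha>\<beta> by (intro scale) auto
  have "norm (L *\<^sub>R part2 emb ?r) \<le> norm (part2 emb m)"
    using KL floor_cell_abs_le[OF KL(2)]
    by (intro norm_le_componentwise_cart) (simp add: part2_def cell_def abs_mult)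
  then have 2: "norm (part2 emb ?r) powr (2 * \<beta>) \<le> L powr (- (2 * \<beta>)) * norm (part2 emb m) powr (2 * \<beta>)"
    using KL \<alpha>\<beta> by (intro scale) auto
  have "a * x + b * y \<le> (a + b) * (x + y)" if "a \<ge> 0" "b \<ge> 0" "x \<ge> 0" "y \<ge> 0" for a b x y :: real
    using that by (simp add: algebra_simps)
  from this[of "K powr (- (2 * \<alpha>))" "L powr (- (2 * \<beta>))"
      "norm (freq emb P m) powr (2 * \<alpha>)" "norm (part2 emb m) powr (2 * \<beta>)"]
  have "lattice_weight emb \<alpha> \<beta> ?r \<le> (K powr (- (2 * \<alpha>)) + L powr (- (2 * \<beta>))) *
      (norm (freq emb P m) powr (2 * \<alpha>) + norm (part2 emb m) powr (2 * \<beta>))"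
    using 1 2 unfolding lattice_weight_def by simp
  then show ?thesis
    using \<alpha>\<beta> by (simp add: weight_def rpow_def)
qed

text \<open>On congruent indices \<open>cell\<close> is injective, so the sum can be reindexed by
  nonzero lattice points. A nonzero cell also excludes a vanishing weight.\<close>

lemma class_weight_sum_le:
  fixes emb :: "'d::finite \<Rightarrow> 'n::finite"
  assumes emb: "inj emb" and \<alpha>\<beta>: "\<alpha> > 0" "\<beta> > 0" and KL: "K > 0" "L > 0"
    and S: "\<And>F. finite F \<Longrightarrow> 0 \<notin> F \<Longrightarrow> (\<Sum>r\<in>F. 1 / lattice_weight emb \<alpha> \<beta> r) \<le> S"
    and F: "finite F"
    and cong: "\<And>m m' j. m \<in> F \<Longrightarrow> m' \<in> F \<Longrightarrow>
      \<exists>z. real_of_int (m $ j) = real_of_int (m' $ j) + 2 * (if j \<in> range emb then K else L) * real_of_int z"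
    and nz: "\<And>m. m \<in> F \<Longrightarrow> cell emb P K L m \<noteq> 0"
  shows "(\<Sum>m\<in>F. 1 / weight emb P \<alpha> \<beta> m) \<le> (K powr (- (2 * \<alpha>)) + L powr (- (2 * \<beta>))) * S"
    and "\<And>m. m \<in> F \<Longrightarrow> weight emb P \<alpha> \<beta> m > 0"
proof -
  define c where "c = K powr (- (2 * \<alpha>)) + L powr (- (2 * \<beta>))"
  have c: "c > 0"
    using KL by (simp add: c_def add_pos_pos)
  have ge: "1 \<le> lattice_weight emb \<alpha> \<beta> (cell emb P K L m)" if "m \<in> F" for m
    using lattice_weight_ge_1[OF \<alpha>\<beta> nz[OF that]] .
  have le: "lattice_weight emb \<alpha> \<beta> (cell emb P K L m) \<le> c * weight emb P \<alpha> \<beta> m" for m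
    using lattice_weight_cell_le[OF emb \<alpha>\<beta> KL] by (simp add: c_def)
  show pos: "weight emb P \<alpha> \<beta> m > 0" if "m \<in> F" for m
  proof -
    have "0 < c * weight emb P \<alpha> \<beta> m"
      using ge[OF that] le[of m] by linarith
    then show ?thesis
      using c by (simp add: zero_less_mult_iff)
  qed
  have inj: "inj_on (cell emb P K L) F"
  proof (rule inj_onI)
    fix m m' assume "m \<in> F" "m' \<in> F" "cell emb P K L m = cell emb P K L m'"
    then show "m = m'"
      using cell_inj[OF emb KL cong] by blast
  qed
  have "(\<Sum>m\<in>F. 1 / weight emb P \<alpha> \<beta> m) \<le> (\<Sum>m\<in>F. c * (1 / lattice_weight emb \<alpha> \<beta> (cell emb P K L m)))"
  proof (rule sum_mono)
    fix m assume m: "m \<in> F"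
    show "1 / weight emb P \<alpha> \<beta> m \<le> c * (1 / lattice_weight emb \<alpha> \<beta> (cell emb P K L m))"
      using ge[OF m] le[of m] pos[OF m] by (simp add: field_simps)
  qed
  also have "\<dots> = c * (\<Sum>r\<in>cell emb P K L ` F. 1 / lattice_weight emb \<alpha> \<beta> r)"
    by (simp add: sum.reindex[OF inj] sum_distrib_left)
  also have "\<dots> \<le> c * S"
    using c F nz by (intro mult_left_mono S) auto
  finally show "(\<Sum>m\<in>F. 1 / weight emb P \<alpha> \<beta> m) \<le> (K powr (- (2 * \<alpha>)) + L powr (- (2 * \<beta>))) * S"
    by (simp add: c_def)
qed

lemma weighted_Cauchy_Schwarz:
  fixes a w :: "'a \<Rightarrow> real"
  assumes "\<And>m. m \<in> F \<Longrightarrow> w m > 0"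
  shows "(\<Sum>m\<in>F. a m)\<^sup>2 \<le> (\<Sum>m\<in>F. 1 / w m) * (\<Sum>m\<in>F. w m * (a m)\<^sup>2)"
proof -
  have "(\<Sum>m\<in>F. a m) = (\<Sum>m\<in>F. (1 / sqrt (w m)) * (sqrt (w m) * a m))"
    by (rule sum.cong) (use assms in \<open>auto simp: less_imp_neq[symmetric]\<close>)
  also have "\<dots>\<^sup>2 \<le> (\<Sum>m\<in>F. (1 / sqrt (w m))\<^sup>2) * (\<Sum>m\<in>F. (sqrt (w m) * a m)\<^sup>2)"
    by (rule Cauchy_Schwarz_ineq_sum)
  also have "\<dots> = (\<Sum>m\<in>F. 1 / w m) * (\<Sum>m\<in>F. w m * (a m)\<^sup>2)"
    using assms by (simp add: power_divide power_mult_distrib less_imp_le)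
  finally show ?thesis .
qed

section \<open>The interpolation error\<close>

text \<open>Turns membership into an equation between cells, so that the injectivity of
  \<open>cell\<close> on congruent indices applies to the index set.\<close>

lemma index_set_iff_cell:
  fixes emb :: "'d::finite \<Rightarrow> 'n::finite"
  assumes emb: "inj emb" and KL: "K > 0" "L > 0"
  shows "k \<in> index_set emb P K L \<longleftrightarrow> cell emb P (real K) (real L) k = 0"
proof -
  have fl: "\<lfloor>(x + real M) / (2 * real M)\<rfloor> = 0 \<longleftrightarrow> x \<in> {- real M..<real M}" if "M > 0" for x M
    using that by (auto simp: floor_eq_iff field_simps)
  have II: "k $ j \<in> {- int L..<int L} \<longleftrightarrow> real_of_int (k $ j) \<in> {- real L..<real L}" for j
    by auto
  have "cell emb P (real K) (real L) k = 0 \<longleftrightarrow>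
      (\<forall>j. j \<notin> range emb \<longrightarrow> \<lfloor>(real_of_int (k $ j) + real L) / (2 * real L)\<rfloor> = 0) \<and>
      (\<forall>i. \<lfloor>(freq emb P k $ i + real K) / (2 * real K)\<rfloor> = 0)"
    using emb by (force simp: cell_def vec_eq_iff)
  then show ?thesis
    unfolding index_set_def mem_Collect_eq fl[OF KL(1)] fl[OF KL(2)] II by (rule sym)
qed

lemma alias_class_self: "k \<in> alias_class emb K L k"
  by (simp add: alias_class_def)

lemma alias_class_cong:
  assumes "m \<in> alias_class emb K L k" "m' \<in> alias_class emb K L k"
  shows "\<exists>z. real_of_int (m $ j) = real_of_int (m' $ j) +
    2 * (if j \<in> range emb then real K else real L) * real_of_int z"
proof -
  have "2 * int (if j \<in> range emb then K else L) dvd (m $ j - k $ j) - (m' $ j - k $ j)"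
    using assms unfolding alias_class_def by (blast intro: dvd_diff)
  then obtain z where "m $ j - m' $ j = 2 * int (if j \<in> range emb then K else L) * z"
    by (auto simp: dvd_def)
  then have "real_of_int (m $ j - m' $ j) = real_of_int (2 * int (if j \<in> range emb then K else L) * z)"
    by (rule arg_cong)
  then show ?thesis
    by (intro exI[of _ z]) (auto split: if_splits)
qed

lemma index_set_alias_eq:
  fixes emb :: "'d::finite \<Rightarrow> 'n::finite"
  assumes "inj emb" "K > 0" "L > 0" "k \<in> index_set emb P K L" "k' \<in> index_set emb P K L"
    and "k' \<in> alias_class emb K L k"
  shows "k' = k"
proof (rule cell_inj[OF assms(1)])
  show "cell emb P (real K) (real L) k' = cell emb P (real K) (real L) k"
    using assms(4,5) index_set_iff_cell[OF assms(1-3)] by metis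
  show "real K > 0" "real L > 0"
    using assms by simp_all
qed (rule alias_class_cong[OF assms(6) alias_class_self])

lemma alias_class_sym: "m \<in> alias_class emb K L k \<longleftrightarrow> k \<in> alias_class emb K L m"
  unfolding alias_class_def by (simp add: dvd_diff_commute)

lemma alias_class_trans:
  assumes "m \<in> alias_class emb K L k" "k' \<in> alias_class emb K L m"
  shows "k' \<in> alias_class emb K L k"
  unfolding alias_class_def mem_Collect_eq
proof
  fix j
  have "2 * int (if j \<in> range emb then K else L) dvd (m $ j - k $ j) + (k' $ j - m $ j)"
    using assms unfolding alias_class_def by (blast intro: dvd_add)
  then show "2 * int (if j \<in> range emb then K else L) dvd k' $ j - k $ j"
    by simp
qed

text \<open>Distinct elements of the index set are incongruent, so taking residues embeds it into a
  finite box; no geometry of the skew region enters.\<close>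

lemma finite_index_set:
  fixes emb :: "'d::finite \<Rightarrow> 'n::finite"
  assumes "inj emb" "K > 0" "L > 0"
  shows "finite (index_set emb P K L)"
proof -
  define M where "M j = 2 * int (if j \<in> range emb then K else L)" for j
  define res :: "int^'n \<Rightarrow> int^'n" where "res k = (\<chi> j. k $ j mod M j)" for k
  have M: "M j > 0" for j
    using assms by (simp add: M_def)
  have "inj_on res (index_set emb P K L)"
  proof (rule inj_onI)
    fix k k' assume k: "k \<in> index_set emb P K L" "k' \<in> index_set emb P K L" and eq: "res k = res k'"
    have "k' $ j mod M j = k $ j mod M j" for j
      using eq by (metis res_def vec_lambda_beta)
    then have "k' \<in> alias_class emb K L k"
      unfolding alias_class_def M_def[symmetric] by (simp add: mod_eq_dvd_iff)
    then show "k = k'"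
      using index_set_alias_eq[OF assms k] by simp
  qed
  moreover have "res ` index_set emb P K L \<subseteq> {v. \<forall>j. v $ j \<in> {0..<M j}}"
    using M by (auto simp: res_def)
  moreover have "finite {v :: int^'n. \<forall>j. v $ j \<in> {0..<M j}}"
    by (rule finite_vec_box) simp
  ultimately show ?thesis
    by (meson finite_imageD finite_subset)
qed

section \<open>Comparison of weights of different orders\<close>

text \<open>\<open>Z\<close> dominates both 1 and \<open>(x / M) powr (2 * \<alpha>)\<close>. The
  former settles \<open>x \<le> M\<close>; for \<open>x > M\<close>, raising the exponent from
  \<open>2 * \<mu>\<close> to \<open>2 * \<alpha>\<close> increases the power of
  \<open>x / M\<close>.\<close>

lemma rpow_le_scaled:
  assumes "x \<ge> 0" "M > 0" "0 \<le> \<mu>" "\<mu> \<le> \<alpha>" "1 \<le> Z" "M powr (- (2 * \<alpha>)) * x powr (2 * \<alpha>) \<le> Z"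
  shows "rpow x (2 * \<mu>) \<le> M powr (2 * \<mu>) * Z"
proof (cases "\<mu> = 0")
  case True
  then show ?thesis
    using assms by (simp add: rpow_def)
next
  case False
  show ?thesis
  proof (cases "x \<le> M")
    case True
    have "x powr (2 * \<mu>) \<le> M powr (2 * \<mu>) * 1"
      using True assms by (simp add: powr_mono2)
    also have "\<dots> \<le> M powr (2 * \<mu>) * Z"
      using assms by (intro mult_left_mono) auto
    finally show ?thesis
      using False by (simp add: rpow_def)
  next
    case nle: False
    have "x powr (2 * \<mu>) = M powr (2 * \<mu>) * (x / M) powr (2 * \<mu>)"
      using assms by (simp add: powr_divide)
    also have "\<dots> \<le> M powr (2 * \<mu>) * (x / M) powr (2 * \<alpha>)"
      using nle assms by (intro mult_left_mono powr_mono) auto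
    also have "(x / M) powr (2 * \<alpha>) = M powr (- (2 * \<alpha>)) * x powr (2 * \<alpha>)"
      using assms by (simp add: powr_divide powr_minus field_simps)
    also have "M powr (2 * \<mu>) * \<dots> \<le> M powr (2 * \<mu>) * Z"
      using assms by (intro mult_left_mono) auto
    finally show ?thesis
      using False by (simp add: rpow_def)
  qed
qed

lemma powr_double: "x powr (2 * a) = (x powr a)\<^sup>2" for x :: real
  by (simp only: mult_2 powr_add power2_eq_square)

lemma sum_squares_le_square_sum:
  assumes "x \<ge> (0::real)" "y \<ge> 0"
  shows "x\<^sup>2 + y\<^sup>2 \<le> (x + y)\<^sup>2"
  using assms by (simp add: power2_sum)

lemma powr_weights_le:
  fixes K L :: nat
  shows "real K powr (2 * \<mu>) + real L powr (2 * \<nu>) \<le> (real K powr \<mu> + real L powr \<nu>)\<^sup>2"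
  unfolding powr_double by (rule sum_squares_le_square_sum) auto

lemma powr_weights_ge_1:
  fixes K L :: nat
  assumes "K > 0" "L > 0" "\<mu> \<ge> 0" "\<nu> \<ge> 0"
  shows "1 \<le> (real K powr \<mu> + real L powr \<nu>)\<^sup>2"
proof -
  have "1 \<le> real K powr \<mu>"
    using assms by (intro ge_one_powr_ge_zero) auto
  then have "1 \<le> real K powr \<mu> + real L powr \<nu>"
    by (simp add: add_increasing2)
  then show ?thesis
    by (simp add: one_le_power)
qed

text \<open>Outside the index set the cell is nonzero, so the rescaled weight \<open>Z\<close> is at
  least 1. It therefore absorbs the low powers of both blocks as well as the constant 1; the factor
  2 accounts for the constant and the lower-order weight separately.\<close>

lemma weight_outside_index_set:
  fixes emb :: "'d::finite \<Rightarrow> 'n::finite"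
  assumes emb: "inj emb" and \<alpha>\<beta>: "\<alpha> > 0" "\<beta> > 0" and \<mu>\<nu>: "\<mu> \<in> {0..\<alpha>}" "\<nu> \<in> {0..\<beta>}"
    and KL: "K > 0" "L > 0" and k: "k \<notin> index_set emb P K L"
  shows "1 + weight emb P \<mu> \<nu> k \<le>
    2 * ((real K powr (- \<alpha>) + real L powr (- \<beta>)) * (real K powr \<mu> + real L powr \<nu>))\<^sup>2 * weight emb P \<alpha> \<beta> k"
proof -
  define c where "c = real K powr (- (2 * \<alpha>)) + real L powr (- (2 * \<beta>))"
  define Z where "Z = c * weight emb P \<alpha> \<beta> k"
  define x where "x = norm (freq emb P k)"
  define y where "y = norm (part2 emb k)"
  have W: "weight emb P \<alpha> \<beta> k = x powr (2 * \<alpha>) + y powr (2 * \<beta>)"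
    using \<alpha>\<beta> by (simp add: weight_def rpow_def x_def y_def)
  have "cell emb P (real K) (real L) k \<noteq> 0"
    using k index_set_iff_cell[OF emb KL] by blast
  from lattice_weight_ge_1[OF \<alpha>\<beta> this, of emb] have Z1: "1 \<le> Z"
    using lattice_weight_cell_le[OF emb \<alpha>\<beta>, of "real K" "real L" P k] KL
    by (simp add: Z_def c_def)
  have "real K powr (- (2 * \<alpha>)) * x powr (2 * \<alpha>) \<le> Z"
    unfolding Z_def c_def W by (intro mult_mono) auto
  then have 1: "rpow x (2 * \<mu>) \<le> real K powr (2 * \<mu>) * Z"
    using \<mu>\<nu> KL Z1 by (intro rpow_le_scaled) (auto simp: x_def)
  have "real L powr (- (2 * \<beta>)) * y powr (2 * \<beta>) \<le> Z"
    unfolding Z_def c_def W by (intro mult_mono) auto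
  then have 2: "rpow y (2 * \<nu>) \<le> real L powr (2 * \<nu>) * Z"
    using \<mu>\<nu> KL Z1 by (intro rpow_le_scaled) (auto simp: y_def)
  define h where "h = (real K powr \<mu> + real L powr \<nu>)\<^sup>2"
  have h: "real K powr (2 * \<mu>) + real L powr (2 * \<nu>) \<le> h" "1 \<le> h"
    unfolding h_def using \<mu>\<nu> KL by (auto intro!: powr_weights_le powr_weights_ge_1)
  have "1 + weight emb P \<mu> \<nu> k \<le> 1 * Z + (real K powr (2 * \<mu>) + real L powr (2 * \<nu>)) * Z"
    using 1 2 Z1 by (simp add: weight_def x_def y_def algebra_simps)
  also have "\<dots> \<le> h * Z + h * Z"
    using h Z1 by (intro add_mono mult_right_mono) auto
  also have "\<dots> = 2 * h * c * weight emb P \<alpha> \<beta> k"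
    by (simp add: Z_def)
  also have "\<dots> \<le> 2 * h * (real K powr (- \<alpha>) + real L powr (- \<beta>))\<^sup>2 * weight emb P \<alpha> \<beta> k"
    using powr_weights_le[of K "- \<alpha>" L "- \<beta>"] h
    by (intro mult_right_mono mult_left_mono) (auto simp: c_def weight_nonneg)
  finally show ?thesis
    by (simp add: h_def power_mult_distrib mult_ac)
qed

lemma rpow_le_card:
  assumes "x \<ge> 0" "x \<le> real n * M" "n > 0" "M > 0" "\<mu> \<ge> 0"
  shows "rpow x (2 * \<mu>) \<le> real n powr (2 * \<mu>) * M powr (2 * \<mu>)"
proof (cases "\<mu> = 0")
  case False
  have "x powr (2 * \<mu>) \<le> (real n * M) powr (2 * \<mu>)"
    using assms by (intro powr_mono2) auto
  then show ?thesis
    using False assms by (simp add: rpow_def powr_mult)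
qed (use assms in \<open>simp add: rpow_def\<close>)

text \<open>The inverse inequality for the trigonometric polynomials spanned by the index set. The
  dimensional factors arise from bounding Euclidean norms by sums of absolute values of
  coordinates.\<close>

lemma weight_on_index_set:
  fixes emb :: "'d::finite \<Rightarrow> 'n::finite"
  assumes \<mu>\<nu>: "\<mu> \<ge> 0" "\<nu> \<ge> 0" and KL: "K > 0" "L > 0" and k: "k \<in> index_set emb P K L"
  shows "1 + weight emb P \<mu> \<nu> k \<le>
    (1 + real CARD('d) powr (2 * \<mu>) + real CARD('n) powr (2 * \<nu>)) * (real K powr \<mu> + real L powr \<nu>)\<^sup>2"
proof -
  define h where "h = (real K powr \<mu> + real L powr \<nu>)\<^sup>2"
  have h: "real K powr (2 * \<mu>) + real L powr (2 * \<nu>) \<le> h" "1 \<le> h"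
    unfolding h_def using \<mu>\<nu> KL by (auto intro!: powr_weights_le powr_weights_ge_1)
  then have hK: "real K powr (2 * \<mu>) \<le> h" "real L powr (2 * \<nu>) \<le> h"
    using powr_ge_zero[of "real K" "2 * \<mu>"] powr_ge_zero[of "real L" "2 * \<nu>"] by linarith+
  have "norm (freq emb P k) \<le> (\<Sum>i\<in>UNIV. \<bar>freq emb P k $ i\<bar>)"
    by (rule norm_le_l1_cart)
  also have "\<dots> \<le> real CARD('d) * real K"
  proof (rule sum_bounded_above)
    fix i
    have "freq emb P k $ i \<in> {- real K..<real K}"
      using k by (simp add: index_set_def)
    then show "\<bar>freq emb P k $ i\<bar> \<le> real K"
      by auto
  qed
  finally have "rpow (norm (freq emb P k)) (2 * \<mu>) \<le> real CARD('d) powr (2 * \<mu>) * real K powr (2 * \<mu>)"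
    using \<mu>\<nu> KL by (intro rpow_le_card) auto
  also have "\<dots> \<le> real CARD('d) powr (2 * \<mu>) * h"
    using hK by (intro mult_left_mono) auto
  finally have 1: "rpow (norm (freq emb P k)) (2 * \<mu>) \<le> real CARD('d) powr (2 * \<mu>) * h" .
  have "norm (part2 emb k) \<le> (\<Sum>j\<in>UNIV. \<bar>part2 emb k $ j\<bar>)"
    by (rule norm_le_l1_cart)
  also have "\<dots> \<le> real CARD('n) * real L"
  proof (rule sum_bounded_above)
    fix j
    show "\<bar>part2 emb k $ j\<bar> \<le> real L"
    proof (cases "j \<in> range emb")
      case False
      then have "k $ j \<in> {- int L..<int L}"
        using k by (simp add: index_set_def)
      then show ?thesis
        using False by (auto simp: part2_def)
    qed (simp add: part2_def)
  qed
  finally have "rpow (norm (part2 emb k)) (2 * \<nu>) \<le> real CARD('n) powr (2 * \<nu>) * real L powr (2 * \<nu>)"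
    using \<mu>\<nu> KL by (intro rpow_le_card) auto
  also have "\<dots> \<le> real CARD('n) powr (2 * \<nu>) * h"
    using hK by (intro mult_left_mono) auto
  finally have 2: "rpow (norm (part2 emb k)) (2 * \<nu>) \<le> real CARD('n) powr (2 * \<nu>) * h" .
  show ?thesis
    using 1 2 h(2) unfolding h_def[symmetric] by (simp add: weight_def distrib_right)
qed

section \<open>Summability and aliasing by Cauchy-Schwarz\<close>

text \<open>Congruence is a hypothesis and the scales are real because the estimate serves twice:
  for punctured alias classes, and for the whole lattice with cells of width one.\<close>

lemma finite_coeff_sum_le:
  fixes emb :: "'d::finite \<Rightarrow> 'n::finite" and a :: "int^'n \<Rightarrow> real"
  assumes emb: "inj emb" and \<alpha>\<beta>: "\<alpha> > 0" "\<beta> > 0" and KL: "K > 0" "L > 0"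
    and S: "\<And>F. finite F \<Longrightarrow> 0 \<notin> F \<Longrightarrow> (\<Sum>r\<in>F. 1 / lattice_weight emb \<alpha> \<beta> r) \<le> S"
    and F: "finite F"
    and cong: "\<And>m m' j. m \<in> F \<Longrightarrow> m' \<in> F \<Longrightarrow>
      \<exists>z. real_of_int (m $ j) = real_of_int (m' $ j) + 2 * (if j \<in> range emb then K else L) * real_of_int z"
    and nz: "\<And>m. m \<in> F \<Longrightarrow> cell emb P K L m \<noteq> 0"
    and T: "(\<Sum>m\<in>F. weight emb P \<alpha> \<beta> m * (a m)\<^sup>2) \<le> T"
  shows "(\<Sum>m\<in>F. a m) \<le> sqrt ((K powr (- (2 * \<alpha>)) + L powr (- (2 * \<beta>))) * S * T)"
proof (rule real_le_rsqrt)
  note W = class_weight_sum_le[OF emb \<alpha>\<beta> KL S F cong nz]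
  have "(\<Sum>m\<in>F. a m)\<^sup>2 \<le> (\<Sum>m\<in>F. 1 / weight emb P \<alpha> \<beta> m) * (\<Sum>m\<in>F. weight emb P \<alpha> \<beta> m * (a m)\<^sup>2)"
    by (rule weighted_Cauchy_Schwarz) (rule W(2))
  also have "\<dots> \<le> (K powr (- (2 * \<alpha>)) + L powr (- (2 * \<beta>))) * S * T"
  proof (rule mult_mono[OF W(1) T])
    have "0 \<le> S"
      using S[of "{}"] by simp
    then show "0 \<le> (K powr (- (2 * \<alpha>)) + L powr (- (2 * \<beta>))) * S"
      by simp
  qed (auto intro!: sum_nonneg mult_nonneg_nonneg weight_nonneg)
  finally show "(\<Sum>m\<in>F. a m)\<^sup>2 \<le> (K powr (- (2 * \<alpha>)) + L powr (- (2 * \<beta>))) * S * T" .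
qed

text \<open>Provides the absolute convergence of the Fourier series on which inversion and the
  aliasing formula rest.\<close>

lemma summable_on_of_weighted_squares:
  fixes emb :: "'d::finite \<Rightarrow> 'n::finite" and a :: "int^'n \<Rightarrow> real"
  assumes emb: "inj emb" and \<alpha>\<beta>: "\<alpha> > 0" "\<beta> > 0"
    and S: "\<And>F. finite F \<Longrightarrow> 0 \<notin> F \<Longrightarrow> (\<Sum>r\<in>F. 1 / lattice_weight emb \<alpha> \<beta> r) \<le> S"
    and a: "\<And>m. a m \<ge> 0"
    and summable: "(\<lambda>m. weight emb P \<alpha> \<beta> m * (a m)\<^sup>2) summable_on UNIV"
  shows "a summable_on UNIV"
proof -
  \<comment> \<open>With half-integer cells all of \<open>\<int>\<^sup>n\<close> is a single congruence class.\<close>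
  let ?cell = "cell emb P (1 / 2) (1 / 2)"
  have cong: "\<exists>z. real_of_int (m $ j) = real_of_int (m' $ j) +
      2 * (if j \<in> range emb then 1 / 2 else 1 / 2) * real_of_int z" for m m' :: "int^'n" and j
    by (rule exI[of _ "m $ j - m' $ j"]) simp
  have "inj ?cell"
  proof (rule injI)
    fix m m' assume eq: "?cell m = ?cell m'"
    show "m = m'"
      by (rule cell_inj[OF emb _ _ cong eq]) simp_all
  qed
  \<comment> \<open>Cell zero, which contains the origin with its vanishing weight, is split off; by
    injectivity it holds at most one index.\<close>
  then have "finite (?cell -` {0})"
    by (simp add: finite_vimageI)
  then have 1: "a summable_on (?cell -` {0})"
    by simp
  define T where "T = infsum (\<lambda>m. weight emb P \<alpha> \<beta> m * (a m)\<^sup>2) UNIV"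
  have "sum a F \<le> sqrt (((1 / 2) powr (- (2 * \<alpha>)) + (1 / 2) powr (- (2 * \<beta>))) * S * T)"
    if F: "finite F" "F \<subseteq> - (?cell -` {0})" for F
  proof (rule finite_coeff_sum_le[OF emb \<alpha>\<beta> _ _ S F(1) cong])
    show "(\<Sum>m\<in>F. weight emb P \<alpha> \<beta> m * (a m)\<^sup>2) \<le> T"
      unfolding T_def by (rule finite_sum_le_infsum[OF summable F(1)]) (auto simp: weight_nonneg)
  qed (use F in auto)
  then have "bdd_above (sum a ` {F. F \<subseteq> - (?cell -` {0}) \<and> finite F})"
    by (intro bdd_aboveI2) auto
  then have 2: "a summable_on (- (?cell -` {0}))"
    by (intro nonneg_bdd_above_summable_on a)
  from summable_on_Un_disjoint[OF 1 2] show ?thesis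
    by (simp add: Compl_partition)
qed

lemma aliasing_error_le:
  fixes emb :: "'d::finite \<Rightarrow> 'n::finite"
  assumes emb: "inj emb" and \<alpha>\<beta>: "\<alpha> > 0" "\<beta> > 0" and KL: "K > 0" "L > 0"
    and S: "\<And>F. finite F \<Longrightarrow> 0 \<notin> F \<Longrightarrow> (\<Sum>r\<in>F. 1 / lattice_weight emb \<alpha> \<beta> r) \<le> S"
    and U: "continuous_on_torus U" and k: "k \<in> index_set emb P K L"
    and summable: "(\<lambda>m. weight emb P \<alpha> \<beta> m * (cmod (fourier_coeff U m))\<^sup>2) summable_on UNIV"
  shows "(cmod (fourier_coeff U k - discrete_coeff emb K L U k))\<^sup>2 \<le>
    (real K powr (- \<alpha>) + real L powr (- \<beta>))\<^sup>2 * S *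
    infsum (\<lambda>m. weight emb P \<alpha> \<beta> m * (cmod (fourier_coeff U m))\<^sup>2) (alias_class emb K L k - {k})"
proof -
  define A where "A = alias_class emb K L k - {k}"
  define T where "T = infsum (\<lambda>m. weight emb P \<alpha> \<beta> m * (cmod (fourier_coeff U m))\<^sup>2) A"
  define c where "c = real K powr (- (2 * \<alpha>)) + real L powr (- (2 * \<beta>))"
  have abs: "(\<lambda>m. cmod (fourier_coeff U m)) summable_on UNIV"
    by (rule summable_on_of_weighted_squares[OF emb \<alpha>\<beta> S _ summable]) auto
  have absA: "(\<lambda>m. cmod (fourier_coeff U m)) summable_on A"
    by (rule summable_on_subset_banach[OF abs]) simp
  have sumA: "(\<lambda>m. weight emb P \<alpha> \<beta> m * (cmod (fourier_coeff U m))\<^sup>2) summable_on A"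
    by (rule summable_on_subset_banach[OF summable]) simp
  \<comment> \<open>Removing the term of \<open>k\<close> itself from its class leaves precisely the
    aliasing error.\<close>
  have "(fourier_coeff U has_sum (discrete_coeff emb K L U k - fourier_coeff U k)) A"
    unfolding A_def
    by (intro has_sum_Diff discrete_coeff_has_sum emb KL U abs has_sum_finiteI)
       (auto simp: alias_class_self)
  then have "cmod (discrete_coeff emb K L U k - fourier_coeff U k) \<le>
      infsum (\<lambda>m. cmod (fourier_coeff U m)) A"
    by (rule norm_has_sum_bound[OF has_sum_infsum[OF absA]])
  also have "\<dots> \<le> sqrt (c * S * T)"
  proof (rule infsum_le_finite_sums[OF absA])
    fix F assume F: "finite F" "F \<subseteq> A"
    show "(\<Sum>m\<in>F. cmod (fourier_coeff U m)) \<le> sqrt (c * S * T)"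
      unfolding c_def
    proof (rule finite_coeff_sum_le[OF emb \<alpha>\<beta> _ _ S F(1)])
      show "(\<Sum>m\<in>F. weight emb P \<alpha> \<beta> m * (cmod (fourier_coeff U m))\<^sup>2) \<le> T"
        unfolding T_def by (rule finite_sum_le_infsum[OF sumA F]) (auto simp: weight_nonneg)
    next
      fix m assume "m \<in> F"
      \<comment> \<open>The class meets the index set only in \<open>k\<close>, so every proper
        alias sits in a nonzero cell.\<close>
      then have "m \<notin> index_set emb P K L"
        using F index_set_alias_eq[OF emb KL k] by (auto simp: A_def)
      then show "cell emb P (real K) (real L) m \<noteq> 0"
        using index_set_iff_cell[OF emb KL] by blast
    next
      fix m m' j assume "m \<in> F" "m' \<in> F"
      then show "\<exists>z. real_of_int (m $ j) = real_of_int (m' $ j) +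
          2 * (if j \<in> range emb then real K else real L) * real_of_int z"
        using F by (intro alias_class_cong[of m _ _ _ k m']) (auto simp: A_def)
    qed (use KL in auto)
  qed
  finally have "(cmod (fourier_coeff U k - discrete_coeff emb K L U k))\<^sup>2 \<le> (sqrt (c * S * T))\<^sup>2"
    by (intro power_mono) (auto simp: norm_minus_commute)
  also have "\<dots> = c * S * T"
  proof -
    have "0 \<le> S" "0 \<le> T"
      using S[of "{}"] by (auto simp: T_def intro!: infsum_nonneg mult_nonneg_nonneg weight_nonneg)
    then show ?thesis
      by (simp add: c_def)
  qed
  also have "\<dots> \<le> (real K powr (- \<alpha>) + real L powr (- \<beta>))\<^sup>2 * S * T"
  proof (intro mult_right_mono)
    show "0 \<le> S" "0 \<le> T"
      using S[of "{}"] by (auto simp: T_def intro!: infsum_nonneg mult_nonneg_nonneg weight_nonneg)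
    show "c \<le> (real K powr (- \<alpha>) + real L powr (- \<beta>))\<^sup>2"
      using powr_weights_le[of K "- \<alpha>" L "- \<beta>"] by (simp add: c_def)
  qed
  finally show ?thesis
    by (simp add: T_def A_def)
qed

text \<open>Distinct elements of the index set have disjoint classes, so the aliased tails add up
  without a factor that counts the indices.\<close>

lemma sum_alias_classes_le:
  fixes emb :: "'d::finite \<Rightarrow> 'n::finite" and f :: "int^'n \<Rightarrow> real"
  assumes emb: "inj emb" and KL: "K > 0" "L > 0" and F: "finite F" "F \<subseteq> index_set emb P K L"
    and f: "\<And>m. f m \<ge> 0" "f summable_on UNIV"
  shows "(\<Sum>k\<in>F. infsum f (alias_class emb K L k - {k})) \<le> infsum f UNIV"
proof -
  let ?A = "\<lambda>k. alias_class emb K L k - {k}"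
  have sub: "f summable_on B" for B
    by (rule summable_on_subset_banach[OF f(2)]) simp
  have "(f has_sum (\<Sum>k\<in>F. infsum f (?A k))) (\<Union>k\<in>F. ?A k)"
  proof (rule sum_has_sum[OF F(1)])
    fix k k' assume k: "k \<in> F" "k' \<in> F" "k \<noteq> k'"
    have False if "m \<in> alias_class emb K L k" "m \<in> alias_class emb K L k'" for m
    proof -
      have "k' \<in> alias_class emb K L k"
        using that alias_class_sym alias_class_trans by metis
      then show False
        using index_set_alias_eq[OF emb KL] k F(2) by blast
    qed
    then show "?A k \<inter> ?A k' = {}"
      by blast
  qed (rule has_sum_infsum[OF sub])
  then show ?thesis
    by (rule has_sum_mono2[OF _ has_sum_infsum[OF f(2)]]) (auto simp: f)
qed

section \<open>From finite sums to extended nonnegative norms\<close>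

lemma infsum_ennreal_eq:
  assumes "\<And>x. f x \<ge> 0" "f summable_on UNIV"
  shows "(\<Sum>\<^sub>\<infinity>x. ennreal (f x)) = ennreal (infsum f UNIV)"
  unfolding infsum_nonneg_is_SUPREMUM_ennreal[OF assms(2,1)]
  by (subst nonneg_infsum_complete) (auto simp: sum_ennreal assms(1))

lemma summable_on_of_infsum_ennreal:
  assumes "\<And>x. f x \<ge> 0" "(\<Sum>\<^sub>\<infinity>x. ennreal (f x)) < \<infinity>"
  shows "f summable_on UNIV"
proof (rule nonneg_bdd_above_summable_on)
  obtain B where B: "B \<ge> 0" "(\<Sum>\<^sub>\<infinity>x. ennreal (f x)) = ennreal B"
    using assms(2) by (cases "\<Sum>\<^sub>\<infinity>x. ennreal (f x)") auto
  have "sum f F \<le> B" if "finite F" for F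
  proof -
    have "ennreal (sum f F) = (\<Sum>x\<in>F. ennreal (f x))"
      by (simp add: sum_ennreal assms(1))
    also have "\<dots> \<le> (\<Sum>\<^sub>\<infinity>x. ennreal (f x))"
      by (subst nonneg_infsum_complete) (auto intro!: SUP_upper simp: that)
    finally show ?thesis
      using B by (simp add: ennreal_le_iff)
  qed
  then show "bdd_above (sum f ` {F. F \<subseteq> UNIV \<and> finite F})"
    by (intro bdd_aboveI2[where M = B]) auto
qed (rule assms)

lemma ennsqrt_ennreal: "t \<ge> 0 \<Longrightarrow> ennsqrt (ennreal t) = ennreal (sqrt t)"
  by (simp add: ennsqrt_def)

text \<open>Lets uniform bounds on finite partial sums control the norm of the error, with
  summability as a consequence.\<close>

lemma ennsqrt_infsum_le:
  assumes "\<And>x. f x \<ge> 0" "B \<ge> 0" "\<And>F. finite F \<Longrightarrow> sum f F \<le> B"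
  shows "ennsqrt (\<Sum>\<^sub>\<infinity>x. ennreal (f x)) \<le> ennreal (sqrt B)"
proof -
  have summable: "f summable_on UNIV"
    by (rule nonneg_bdd_above_summable_on) (use assms in \<open>auto intro!: bdd_aboveI2[where M = B]\<close>)
  have "infsum f UNIV \<le> B"
    by (rule infsum_le_finite_sums[OF summable]) (use assms in auto)
  moreover have "infsum f UNIV \<ge> 0"
    by (rule infsum_nonneg) (use assms in auto)
  ultimately show ?thesis
    unfolding infsum_ennreal_eq[OF assms(1) summable] by (simp add: ennsqrt_ennreal ennreal_leI)
qed

lemma qp_seminorm_alt: "qp_seminorm emb P \<alpha> \<beta> u =
    ennsqrt (\<Sum>\<^sub>\<infinity>k. ennreal (weight emb P \<alpha> \<beta> k * (cmod (fourier_coeff (parent P u) k))\<^sup>2))"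
  by (simp add: qp_seminorm_def weight_def)

lemma qp_norm_alt: "qp_norm emb P \<alpha> \<beta> u =
    ennsqrt (\<Sum>\<^sub>\<infinity>k. ennreal ((1 + weight emb P \<alpha> \<beta> k) * (cmod (fourier_coeff (parent P u) k))\<^sup>2))"
  by (simp add: qp_norm_def weight_def add.assoc)

text \<open>Each \<open>phiP P k\<close> is \<open>phi k\<close> composed with the transpose of
  \<open>P\<close>. Hence \<open>U\<close> minus the corresponding trigonometric polynomial is a
  parent of the error, and by uniqueness it is the one selected by \<open>parent\<close>.\<close>

lemma parent_interpolation_error:
  fixes P :: "real^'n^'d" and emb :: "'d \<Rightarrow> 'n"
  assumes emb: "inj emb" and P: "P \<in> projection_matrices" and KL: "K > 0" "L > 0"
    and U: "is_parent P U u"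
  shows "fourier_coeff (parent P (\<lambda>x. u x - interpolation emb P K L u x)) k =
    fourier_coeff U k - (if k \<in> index_set emb P K L then discrete_coeff emb K L U k else 0)"
proof -
  let ?I = "\<lambda>y. \<Sum>k\<in>index_set emb P K L. discrete_coeff emb K L U k * phi k y"
  have phiP: "phiP P k x = phi k (transpose P *v x)" for k x
    by (simp add: phiP_def phi_def dot_lmul_matrix[symmetric] inner_commute)
  have cont: "continuous_on UNIV U" "continuous_on UNIV ?I"
    using U by (auto simp: is_parent_def continuous_on_torus_def intro!: continuous_intros)
  have "is_parent P (\<lambda>y. U y - ?I y) (\<lambda>x. u x - interpolation emb P K L u x)"
    using U cont
    by (auto simp: is_parent_def continuous_on_torus_def interpolation_def phiP phi_periodic
        parent_eq[OF P U] intro!: continuous_intros)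
  then show ?thesis
    using parent_eq[OF P] fourier_coeff_diff[OF cont]
    by (simp add: fourier_coeff_trig_sum[OF finite_index_set[OF emb KL]])
qed

text \<open>Off the index set the error coefficient is that of \<open>U\<close>, and the comparison
  of weights gives the summand 2 of the constant. On it, the inverse inequality multiplies the
  aliasing bound, which gives the summand with \<open>S\<close>.\<close>

lemma interpolation_error_finite_sum:
  fixes P :: "real^'n^'d" and emb :: "'d \<Rightarrow> 'n"
  assumes emb: "inj emb" and P: "P \<in> projection_matrices" and \<alpha>\<beta>: "\<alpha> > 0" "\<beta> > 0"
    and \<mu>\<nu>: "\<mu> \<in> {0..\<alpha>}" "\<nu> \<in> {0..\<beta>}" and KL: "K > 0" "L > 0"
    and S: "\<And>F. finite F \<Longrightarrow> 0 \<notin> F \<Longrightarrow> (\<Sum>r\<in>F. 1 / lattice_weight emb \<alpha> \<beta> r) \<le> S"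
    and U: "is_parent P U u"
    and summable: "(\<lambda>m. weight emb P \<alpha> \<beta> m * (cmod (fourier_coeff U m))\<^sup>2) summable_on UNIV"
    and F: "finite F"
  shows "(\<Sum>k\<in>F. (1 + weight emb P \<mu> \<nu> k) *
      (cmod (fourier_coeff (parent P (\<lambda>x. u x - interpolation emb P K L u x)) k))\<^sup>2) \<le>
    (2 + (1 + real CARD('d) powr (2 * \<mu>) + real CARD('n) powr (2 * \<nu>)) * S) *
    ((real K powr (- \<alpha>) + real L powr (- \<beta>)) * (real K powr \<mu> + real L powr \<nu>))\<^sup>2 *
    infsum (\<lambda>m. weight emb P \<alpha> \<beta> m * (cmod (fourier_coeff U m))\<^sup>2) UNIV"
proof -
  define f where "f m = weight emb P \<alpha> \<beta> m * (cmod (fourier_coeff U m))\<^sup>2" for m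
  define E where "E k = fourier_coeff (parent P (\<lambda>x. u x - interpolation emb P K L u x)) k" for k
  define g where "g = (real K powr (- \<alpha>) + real L powr (- \<beta>))\<^sup>2"
  define h where "h = (real K powr \<mu> + real L powr \<nu>)\<^sup>2"
  define D where "D = 1 + real CARD('d) powr (2 * \<mu>) + real CARD('n) powr (2 * \<nu>)"
  let ?X = "index_set emb P K L"
  let ?A = "\<lambda>k. alias_class emb K L k - {k}"
  have E: "E k = fourier_coeff U k - (if k \<in> ?X then discrete_coeff emb K L U k else 0)" for k
    unfolding E_def by (rule parent_interpolation_error[OF emb P KL U])
  have torus: "continuous_on_torus U"
    using U by (simp add: is_parent_def)
  have f0: "f m \<ge> 0" for m
    by (simp add: f_def weight_nonneg)
  have fs: "f summable_on UNIV"
    using summable by (simp add: f_def[abs_def])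
  have nonneg: "g \<ge> 0" "h \<ge> 0" "D \<ge> 0" "S \<ge> 0"
    using S[of "{}"] by (auto simp: g_def h_def D_def)
  have "(\<Sum>k\<in>F - ?X. (1 + weight emb P \<mu> \<nu> k) * (cmod (E k))\<^sup>2) \<le> (\<Sum>k\<in>F - ?X. 2 * g * h * f k)"
  proof (rule sum_mono)
    fix k assume k: "k \<in> F - ?X"
    have "(1 + weight emb P \<mu> \<nu> k) * (cmod (E k))\<^sup>2 \<le>
        (2 * (g * h) * weight emb P \<alpha> \<beta> k) * (cmod (E k))\<^sup>2"
      using weight_outside_index_set[OF emb \<alpha>\<beta> \<mu>\<nu> KL, of k P] k
      by (intro mult_right_mono) (auto simp: g_def h_def power_mult_distrib)
    then show "(1 + weight emb P \<mu> \<nu> k) * (cmod (E k))\<^sup>2 \<le> 2 * g * h * f k"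
      using k by (simp add: E f_def mult_ac)
  qed
  also have "\<dots> = 2 * g * h * sum f (F - ?X)"
    by (simp add: sum_distrib_left)
  also have "\<dots> \<le> 2 * g * h * infsum f UNIV"
    using nonneg F by (intro mult_left_mono finite_sum_le_infsum fs) (auto simp: f0)
  finally have 1: "(\<Sum>k\<in>F - ?X. (1 + weight emb P \<mu> \<nu> k) * (cmod (E k))\<^sup>2) \<le> 2 * g * h * infsum f UNIV" .
  have "(\<Sum>k\<in>F \<inter> ?X. (1 + weight emb P \<mu> \<nu> k) * (cmod (E k))\<^sup>2) \<le>
      (\<Sum>k\<in>F \<inter> ?X. (D * h) * (g * S * infsum f (?A k)))"
  proof (rule sum_mono)
    fix k assume "k \<in> F \<inter> ?X"
    then have k: "k \<in> ?X"
      by simp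
    have "1 + weight emb P \<mu> \<nu> k \<le> D * h"
      using weight_on_index_set[OF _ _ KL k, of \<mu> \<nu>] \<mu>\<nu> by (simp add: D_def h_def)
    moreover have "(cmod (E k))\<^sup>2 \<le> g * S * infsum f (?A k)"
      using aliasing_error_le[OF emb \<alpha>\<beta> KL S torus k summable] k
      by (simp add: E g_def f_def[abs_def])
    ultimately show "(1 + weight emb P \<mu> \<nu> k) * (cmod (E k))\<^sup>2 \<le> (D * h) * (g * S * infsum f (?A k))"
      using nonneg by (intro mult_mono) auto
  qed
  also have "\<dots> = D * S * g * h * (\<Sum>k\<in>F \<inter> ?X. infsum f (?A k))"
    by (simp add: sum_distrib_left mult_ac)
  also have "\<dots> \<le> D * S * g * h * infsum f UNIV"
    using nonneg F by (intro mult_left_mono sum_alias_classes_le[OF emb KL, where P = P] f0 fs) auto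
  finally have 2: "(\<Sum>k\<in>F \<inter> ?X. (1 + weight emb P \<mu> \<nu> k) * (cmod (E k))\<^sup>2) \<le> D * S * g * h * infsum f UNIV" .
  have "(\<Sum>k\<in>F. (1 + weight emb P \<mu> \<nu> k) * (cmod (E k))\<^sup>2) =
      (\<Sum>k\<in>F \<inter> ?X. (1 + weight emb P \<mu> \<nu> k) * (cmod (E k))\<^sup>2) +
      (\<Sum>k\<in>F - ?X. (1 + weight emb P \<mu> \<nu> k) * (cmod (E k))\<^sup>2)"
    by (rule sum.Int_Diff[OF F])
  also have "\<dots> \<le> (2 + D * S) * (g * h) * infsum f UNIV"
    using 1 2 by (simp add: algebra_simps)
  finally show ?thesis
    unfolding E_def D_def g_def h_def f_def[abs_def] power_mult_distrib .
qed

theorem theorem3p4: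
  fixes P :: "real^'n^'d" and emb :: "'d \<Rightarrow> 'n" and \<alpha> \<beta> \<mu> \<nu> :: real
  assumes "inj emb"
    and "P \<in> projection_matrices"
    and "invertible (block1 emb P)"
    and "\<alpha> \<ge> \<beta>"
    and "\<beta> > (real CARD('n) - real CARD('d)) / 2"
    and "real CARD('d) / (2 * \<alpha>) + (real CARD('n) - real CARD('d)) / (2 * \<beta>) < 1"
    and "\<mu> \<in> {0..\<alpha>}"
    and "\<nu> \<in> {0..\<beta>}"
  shows "\<exists>C::real. C > 0 \<and>
    (\<forall>u \<in> HQ emb P \<alpha> \<beta>. \<forall>K L :: nat. K > 0 \<longrightarrow> L > 0 \<longrightarrow>
      qp_seminorm emb P \<mu> \<nu> (\<lambda>x. u x - interpolation emb P K L u x) \<le>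
        ennreal (C * (real K powr (- \<alpha>) + real L powr (- \<beta>)) * (real K powr \<mu> + real L powr \<nu>)) *
        qp_seminorm emb P \<alpha> \<beta> u \<and>
      qp_norm emb P \<mu> \<nu> (\<lambda>x. u x - interpolation emb P K L u x) \<le>
        ennreal (C * (real K powr (- \<alpha>) + real L powr (- \<beta>)) * (real K powr \<mu> + real L powr \<nu>)) *
        qp_norm emb P \<alpha> \<beta> u)"
proof -
  \<comment> \<open>Injectivity makes \<open>(n - d) / 2\<close> nonnegative, so the lower bound on
    \<open>\<beta>\<close> yields positivity.\<close>
  have "CARD('d) \<le> CARD('n)"
    using assms(1) by (intro card_inj_on_le[of emb]) auto
  then have \<beta>: "\<beta> > 0"
    using assms(5) by (smt (verit) divide_nonneg_nonneg of_nat_mono)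
  then have \<alpha>: "\<alpha> > 0"
    using assms(4) by simp
  obtain S where "S > 0" and
    S: "\<And>F. finite F \<Longrightarrow> 0 \<notin> F \<Longrightarrow> (\<Sum>r\<in>F. 1 / lattice_weight emb \<alpha> \<beta> r) \<le> S"
    using lattice_sum_bounded[OF assms(1) \<alpha> \<beta> assms(6)] by metis
  \<comment> \<open>The constant of the squared estimate; the witness for \<open>C\<close> is its
    square root.\<close>
  define D where "D = 2 + (1 + real CARD('d) powr (2 * \<mu>) + real CARD('n) powr (2 * \<nu>)) * S"
  have D: "D > 0"
    using \<open>S > 0\<close> by (simp add: D_def add_pos_nonneg)
  show ?thesis
  proof (intro exI[of _ "sqrt D"] conjI ballI allI impI)
    show "sqrt D > 0"
      using D by simp
  next
    fix u and K L :: nat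
    assume u: "u \<in> HQ emb P \<alpha> \<beta>" and KL: "K > 0" "L > 0"
    let ?v = "\<lambda>x. u x - interpolation emb P K L u x"
    define \<eta> where "\<eta> = (real K powr (- \<alpha>) + real L powr (- \<beta>)) * (real K powr \<mu> + real L powr \<nu>)"
    define a where "a k = (cmod (fourier_coeff (parent P u) k))\<^sup>2" for k
    define b where "b k = (cmod (fourier_coeff (parent P ?v) k))\<^sup>2" for k
    define W where "W k = weight emb P \<alpha> \<beta> k" for k
    define w where "w k = weight emb P \<mu> \<nu> k" for k
    have nonneg: "a k \<ge> 0" "b k \<ge> 0" "W k \<ge> 0" "w k \<ge> 0" for k
      by (simp_all add: a_def b_def W_def w_def weight_nonneg)
    have \<eta>: "\<eta> \<ge> 0"
      by (simp add: \<eta>_def)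
    obtain U where U: "is_parent P U u"
      using u by (auto simp: HQ_def quasiperiodic_def)
    have "(\<Sum>\<^sub>\<infinity>k. ennreal ((1 + W k) * a k)) < \<infinity>"
      using u by (auto simp: HQ_def qp_norm_alt ennsqrt_def W_def a_def top.not_eq_extremum split: if_splits)
    then have norm_summable: "(\<lambda>k. (1 + W k) * a k) summable_on UNIV"
      by (intro summable_on_of_infsum_ennreal) (auto simp: nonneg)
    then have summable: "(\<lambda>k. W k * a k) summable_on UNIV"
      by (rule summable_on_comparison_test) (auto simp: nonneg mult_right_mono)
    define T where "T = infsum (\<lambda>k. W k * a k) UNIV"
    define T1 where "T1 = infsum (\<lambda>k. (1 + W k) * a k) UNIV"
    have T0: "T \<ge> 0"
      unfolding T_def by (rule infsum_nonneg) (simp add: nonneg)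
    have TT1: "T \<le> T1"
      unfolding T_def T1_def
      by (rule infsum_mono[OF summable norm_summable]) (simp add: nonneg mult_right_mono)
    \<comment> \<open>The full norm of the error is controlled by \<open>T\<close>, the square of
      the seminorm of \<open>u\<close>; both inequalities follow from this one.\<close>
    have bound: "(\<Sum>k\<in>F. (1 + w k) * b k) \<le> D * \<eta>\<^sup>2 * T" if "finite F" for F
      using interpolation_error_finite_sum[OF assms(1,2) \<alpha> \<beta> assms(7,8) KL S U _ that] summable
      unfolding D_def \<eta>_def T_def W_def w_def a_def b_def parent_eq[OF assms(2) U] by blast
    have sqrt_bound: "sqrt (D * \<eta>\<^sup>2 * t) = sqrt D * \<eta> * sqrt t" for t
      using \<eta> by (simp add: real_sqrt_mult)
    have "qp_seminorm emb P \<mu> \<nu> ?v \<le> ennreal (sqrt (D * \<eta>\<^sup>2 * T))"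
      unfolding qp_seminorm_alt w_def[symmetric] b_def[symmetric]
    proof (rule ennsqrt_infsum_le)
      fix F :: "(int^'n) set" assume F: "finite F"
      have "(\<Sum>k\<in>F. w k * b k) \<le> (\<Sum>k\<in>F. (1 + w k) * b k)"
        by (intro sum_mono mult_right_mono) (auto simp: nonneg)
      then show "(\<Sum>k\<in>F. w k * b k) \<le> D * \<eta>\<^sup>2 * T"
        using bound[OF F] by linarith
    qed (use D T0 nonneg in auto)
    also have "\<dots> = ennreal (sqrt D * \<eta>) * ennreal (sqrt T)"
      unfolding sqrt_bound using D \<eta> T0 by (simp add: ennreal_mult)
    also have "ennreal (sqrt T) = qp_seminorm emb P \<alpha> \<beta> u"
      unfolding qp_seminorm_alt W_def[symmetric] a_def[symmetric]
      using infsum_ennreal_eq[OF _ summable] T0 by (simp add: T_def nonneg ennsqrt_ennreal)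
    finally show "qp_seminorm emb P \<mu> \<nu> ?v \<le>
        ennreal (sqrt D * (real K powr (- \<alpha>) + real L powr (- \<beta>)) * (real K powr \<mu> + real L powr \<nu>)) *
        qp_seminorm emb P \<alpha> \<beta> u"
      by (simp only: \<eta>_def mult.assoc)
    have "qp_norm emb P \<mu> \<nu> ?v \<le> ennreal (sqrt (D * \<eta>\<^sup>2 * T))"
      unfolding qp_norm_alt w_def[symmetric] b_def[symmetric]
      by (rule ennsqrt_infsum_le) (use D T0 nonneg bound in auto)
    \<comment> \<open>Passing from \<open>T\<close> to the larger \<open>T1\<close> replaces the
      seminorm of \<open>u\<close> by its full norm.\<close>
    also have "\<dots> \<le> ennreal (sqrt (D * \<eta>\<^sup>2 * T1))"
      using TT1 D by (intro ennreal_leI real_sqrt_le_mono mult_left_mono) auto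
    also have "\<dots> = ennreal (sqrt D * \<eta>) * ennreal (sqrt T1)"
      unfolding sqrt_bound using D \<eta> T0 TT1 by (simp add: ennreal_mult)
    also have "ennreal (sqrt T1) = qp_norm emb P \<alpha> \<beta> u"
      unfolding qp_norm_alt W_def[symmetric] a_def[symmetric]
      using infsum_ennreal_eq[OF _ norm_summable] T0 TT1 by (simp add: T1_def nonneg ennsqrt_ennreal)
    finally show "qp_norm emb P \<mu> \<nu> ?v \<le>
        ennreal (sqrt D * (real K powr (- \<alpha>) + real L powr (- \<beta>)) * (real K powr \<mu> + real L powr \<nu>)) *
        qp_norm emb P \<alpha> \<beta> u"
      by (simp only: \<eta>_def mult.assoc)
  qed
qed

end
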